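(* Let $A_1\subseteq A_2\subseteq\cdots$ be an ascending sequence of unital Banach algebras such that all inclusion maps $A_n\to A_{n+1}$ are continuous homomorphisms of unital algebras, and let $A:=\bigcup_{n\in\mathbb N}A_n$, endowed with the unital algebra structure turning each inclusion map $A_n\to A$ into a homomorphism of unital algebras and with the locally convex direct limit topology. If the direct sequence $A_1\subseteq A_2\subseteq\cdots$ is strict (i.e. each inclusion map $A_n\to A_{n+1}$ is a topological embedding), then the unit group $A^\times$ is a complete topological group.
   Context: The unit group $A^\times$ of a unital algebra $A$ is its group of invertible elements; here $A^\times=\bigcup_nA_n^\times$. The locally convex direct limit topology on $A=\bigcup_nA_n$ is the finest locally convex vector topology making all inclusion maps $A_n\to A$ continuous; it makes $A$ a topological algebra, and $A^\times$ carries the topology induced by $A$, in which it is a topological group. A net $(x_\alpha)_{\alpha\in I}$ in a topological group $G$ is a left Cauchy net if for each identity neighbourhood $U\subseteq G$ there is $\gamma\in I$ with $x_\beta^{-1}x_\alpha\in U$ for all $\alpha,\beta\ge\gamma$. $G$ is complete if every left Cauchy net in $G$ converges. *)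

theory Defs
  imports "HOL-Analysis.Analysis" "HOL-Algebra.Group"
begin

section \<open>Unital Banach algebras on subsets of an algebra\<close>

text \<open>
  The sort \<open>{ring, monoid_mult}\<close> describes associative unital rings; in contrast to
  \<open>ring_1\<close>, it does not exclude the zero ring.  Scalars range over a type of class
  \<open>real_normed_field\<close>, whose norm is multiplicative: by the Gelfand--Mazur theorem, such a
  field is isometrically isomorphic to the real or to the complex numbers, so real and complex
  algebras are treated simultaneously.
\<close>

locale unital_algebra = vector_space smul
  for smul :: "'k::field \<Rightarrow> 'a::{ring, monoid_mult} \<Rightarrow> 'a" +
  assumes mult_scale_left: "smul c x * y = smul c (x * y)"
    and mult_scale_right: "x * smul c y = smul c (x * y)"

text \<open>
  Only the values of \<open>\<nu>\<close> on \<open>S\<close> matter.  The value 0 off \<open>S\<close> is there because the locale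
  \<open>Metric_space\<close> requires nonnegativity and symmetry on the whole type.
\<close>

definition norm_dist :: "'a::ab_group_add set \<Rightarrow> ('a \<Rightarrow> real) \<Rightarrow> 'a \<Rightarrow> 'a \<Rightarrow> real" where
  "norm_dist S \<nu> x y = (if x \<in> S \<and> y \<in> S then \<nu> (x - y) else 0)"

definition norm_topology :: "'a::ab_group_add set \<Rightarrow> ('a \<Rightarrow> real) \<Rightarrow> 'a topology" where
  "norm_topology S \<nu> = Metric_space.mtopology S (norm_dist S \<nu>)"

text \<open>
  The unital subalgebra \<open>S\<close>, with the norm \<open>\<nu>\<close>, is a Banach algebra.  The norm is
  submultiplicative; \<open>\<nu> 1 = 1\<close> is not required.
\<close>

locale unital_Banach_algebra = unital_algebra smul
  for smul :: "'k::real_normed_field \<Rightarrow> 'a::{ring, monoid_mult} \<Rightarrow> 'a" +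
  fixes S :: "'a set" and \<nu> :: "'a \<Rightarrow> real"
  assumes subspace: "module.subspace smul S"
    and one_mem: "1 \<in> S"
    and mult_mem: "\<lbrakk>x \<in> S; y \<in> S\<rbrakk> \<Longrightarrow> x * y \<in> S"
    and norm_nonneg: "x \<in> S \<Longrightarrow> 0 \<le> \<nu> x"
    and norm_eq_zero: "x \<in> S \<Longrightarrow> \<nu> x = 0 \<longleftrightarrow> x = 0"
    and norm_triangle: "\<lbrakk>x \<in> S; y \<in> S\<rbrakk> \<Longrightarrow> \<nu> (x + y) \<le> \<nu> x + \<nu> y"
    and norm_scale: "x \<in> S \<Longrightarrow> \<nu> (smul c x) = norm c * \<nu> x"
    and norm_mult: "\<lbrakk>x \<in> S; y \<in> S\<rbrakk> \<Longrightarrow> \<nu> (x * y) \<le> \<nu> x * \<nu> y"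
    and complete: "Metric_space.mcomplete S (norm_dist S \<nu>)"
begin

lemma Metric_space_norm_dist: "Metric_space S (norm_dist S \<nu>)"
proof
  have diff: "x - y \<in> S" if "x \<in> S" "y \<in> S" for x y
    using that subspace subspace_diff by blast
  have neg: "\<nu> (- x) = \<nu> x" if "x \<in> S" for x
    using norm_scale [OF that, of "- 1"] by simp
  show "0 \<le> norm_dist S \<nu> x y" for x y
    by (simp add: norm_dist_def norm_nonneg diff)
  show "norm_dist S \<nu> x y = norm_dist S \<nu> y x" for x y
    using neg [OF diff, of x y] by (simp add: norm_dist_def)
  show "norm_dist S \<nu> x y = 0 \<longleftrightarrow> x = y" if "x \<in> S" "y \<in> S" for x y
    using that by (simp add: norm_dist_def norm_eq_zero diff)
  show "norm_dist S \<nu> x z \<le> norm_dist S \<nu> x y + norm_dist S \<nu> y z"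
    if "x \<in> S" "y \<in> S" "z \<in> S" for x y z
    using that norm_triangle [OF diff diff, of x y y z] by (simp add: norm_dist_def)
qed

lemma topspace_norm_topology: "topspace (norm_topology S \<nu>) = S"
  unfolding norm_topology_def
  by (rule Metric_space.topspace_mtopology [OF Metric_space_norm_dist])

end

section \<open>Locally convex direct limits\<close>

definition convex_wrt :: "('k::real_normed_field \<Rightarrow> 'a::ab_group_add \<Rightarrow> 'a) \<Rightarrow> 'a set \<Rightarrow> bool" where
  "convex_wrt smul V \<longleftrightarrow>
     (\<forall>x\<in>V. \<forall>y\<in>V. \<forall>t::real. 0 \<le> t \<and> t \<le> 1 \<longrightarrow>
        smul (of_real (1 - t)) x + smul (of_real t) y \<in> V)"

definition locally_convex_vector_topology ::
    "('k::real_normed_field \<Rightarrow> 'a::ab_group_add \<Rightarrow> 'a) \<Rightarrow> 'a topology \<Rightarrow> bool" where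
  "locally_convex_vector_topology smul T \<longleftrightarrow>
     topspace T = UNIV \<and>
     continuous_map (prod_topology T T) T (\<lambda>(x, y). x + y) \<and>
     continuous_map (prod_topology euclidean T) T (\<lambda>(c, x). smul c x) \<and>
     (\<forall>U. openin T U \<and> 0 \<in> U \<longrightarrow>
        (\<exists>V. openin T V \<and> 0 \<in> V \<and> V \<subseteq> U \<and> convex_wrt smul V))"

text \<open>\<open>T\<close> is the finest locally convex vector topology on the type \<open>'a\<close> for which the
  inclusion of each step \<open>topspace (X n)\<close>, with its topology \<open>X n\<close>, is continuous.\<close>

definition lc_direct_limit_topology ::
    "('k::real_normed_field \<Rightarrow> 'a::ab_group_add \<Rightarrow> 'a) \<Rightarrow> (nat \<Rightarrow> 'a topology) \<Rightarrow> 'a topology \<Rightarrow> bool"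
  where
  "lc_direct_limit_topology smul X T \<longleftrightarrow>
     locally_convex_vector_topology smul T \<and>
     (\<forall>n. continuous_map (X n) T (\<lambda>x. x)) \<and>
     (\<forall>T'. locally_convex_vector_topology smul T' \<and> (\<forall>n. continuous_map (X n) T' (\<lambda>x. x)) \<longrightarrow>
        (\<forall>U. openin T' U \<longrightarrow> openin T U))"

lemma lc_direct_limit_topology_unique:
  assumes "lc_direct_limit_topology smul X T" "lc_direct_limit_topology smul X T'"
  shows "T = T'"
  using assms unfolding lc_direct_limit_topology_def by (metis topology_eq)

lemma lc_direct_limit_topology_exists:
  fixes smul :: "'k::real_normed_field \<Rightarrow> 'a::ab_group_add \<Rightarrow> 'a"
  shows "\<exists>T. lc_direct_limit_topology smul X T"
proof -
  define P where "P T \<longleftrightarrow> locally_convex_vector_topology smul T \<and>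
    (\<forall>n. continuous_map (X n) T (\<lambda>x. x))" for T
  define \<S> where "\<S> = {U. \<exists>T. P T \<and> openin T U}"
  define T0 where "T0 = topology_generated_by \<S>"
  define I where "I = topology_generated_by {UNIV :: 'a set}"
  have openI: "U = {} \<or> U = UNIV" if "openin I U" for U
  proof -
    have "generate_topology_on {UNIV} U"
      using that by (simp add: I_def openin_topology_generated_by_iff)
    then show ?thesis by (induction rule: generate_topology_on.induct) auto
  qed
  have topI: "topspace I = UNIV" by (simp add: I_def)
  have contI: "continuous_map Y I f" for Y :: "'b topology" and f
    unfolding I_def by (rule continuous_on_generated_topo) auto
  have "P I"
    unfolding P_def locally_convex_vector_topology_def
  proof (intro conjI allI impI contI topI)
    fix U assume U: "openin I U \<and> 0 \<in> U"
    then have "U = UNIV" using openI by blast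
    then show "\<exists>V. openin I V \<and> 0 \<in> V \<and> V \<subseteq> U \<and> convex_wrt smul V"
      using U by (intro exI [of _ U]) (simp add: convex_wrt_def)
  qed
  then have "UNIV \<in> \<S>" unfolding \<S>_def using topI openin_topspace by (metis mem_Collect_eq)
  then have top0: "topspace T0 = UNIV" unfolding T0_def by auto
  have finer: "openin T0 U" if "P T" "openin T U" for T U
    unfolding T0_def by (rule topology_generated_by_Basis) (use that in \<open>auto simp: \<S>_def\<close>)
  have into: "continuous_map Y T0 f"
    if "\<And>T. P T \<Longrightarrow> continuous_map Y T f" for Y :: "'c topology" and f
    unfolding T0_def
  proof (rule continuous_on_generated_topo)
    fix U assume "U \<in> \<S>"
    then obtain T where "P T" "openin T U" by (auto simp: \<S>_def)
    then show "openin Y (f -` U \<inter> topspace Y)"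
      using that [of T] by (simp add: continuous_map_alt)
  next
    show "f ` topspace Y \<subseteq> \<Union> \<S>" using \<open>UNIV \<in> \<S>\<close> by blast
  qed
  have id0: "continuous_map T0 T (\<lambda>x. x)" if "P T" for T
    using that finer [OF that] top0
    by (auto simp: continuous_map_def P_def locally_convex_vector_topology_def)
  have prod0: "continuous_map (prod_topology Z T0) (prod_topology Z' T) (\<lambda>z. z)"
    if "P T" "continuous_map Z Z' (\<lambda>x. x)" for T and Z Z' :: "'z topology"
    using that id0 [of T]
    by (auto simp: continuous_map_pairwise o_def
        intro: continuous_map_compose [OF continuous_map_fst, unfolded o_def]
          continuous_map_compose [OF continuous_map_snd, unfolded o_def])
  have "P T0"
    unfolding P_def locally_convex_vector_topology_def
  proof (intro conjI allI impI top0)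
    show "continuous_map (prod_topology T0 T0) T0 (\<lambda>(x, y). x + y)"
    proof (rule into)
      fix T assume T: "P T"
      have "continuous_map (prod_topology T T) T (\<lambda>(x, y). x + y)"
        using T by (simp add: P_def locally_convex_vector_topology_def)
      from continuous_map_compose [OF prod0 [OF T id0 [OF T]] this]
      show "continuous_map (prod_topology T0 T0) T (\<lambda>(x, y). x + y)" by (simp add: o_def)
    qed
    show "continuous_map (prod_topology euclidean T0) T0 (\<lambda>(c, x). smul c x)"
    proof (rule into)
      fix T assume T: "P T"
      have "continuous_map (prod_topology euclidean T) T (\<lambda>(c, x). smul c x)"
        using T by (simp add: P_def locally_convex_vector_topology_def)
      from continuous_map_compose [OF prod0 [OF T] this]
      show "continuous_map (prod_topology euclidean T0) T (\<lambda>(c, x). smul c x)" by (simp add: o_def)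
    qed
    show "continuous_map (X n) T0 (\<lambda>x. x)" for n
      by (rule into) (simp add: P_def)
    fix U assume U: "openin T0 U \<and> 0 \<in> U"
    then have "generate_topology_on \<S> U" by (simp add: T0_def openin_topology_generated_by)
    then have "0 \<in> U \<longrightarrow> (\<exists>V. openin T0 V \<and> 0 \<in> V \<and> V \<subseteq> U \<and> convex_wrt smul V)"
    proof (induction rule: generate_topology_on.induct)
      case (Int a b)
      show ?case
      proof
        assume "0 \<in> a \<inter> b"
        then obtain V W where "openin T0 V" "0 \<in> V" "V \<subseteq> a" "convex_wrt smul V"
          "openin T0 W" "0 \<in> W" "W \<subseteq> b" "convex_wrt smul W" using Int by blast
        then show "\<exists>V. openin T0 V \<and> 0 \<in> V \<and> V \<subseteq> a \<inter> b \<and> convex_wrt smul V"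
          by (intro exI [of _ "V \<inter> W"]) (auto simp: convex_wrt_def)
      qed
    next
      case (UN K)
      then show ?case by (meson Union_iff Union_upper subset_trans)
    next
      case (Basis s)
      then obtain T where "P T" "openin T s" by (auto simp: \<S>_def)
      then show ?case using finer [of T]
        unfolding P_def locally_convex_vector_topology_def by meson
    qed auto
    then show "\<exists>V. openin T0 V \<and> 0 \<in> V \<and> V \<subseteq> U \<and> convex_wrt smul V" using U by blast
  qed
  then show ?thesis
    using finer by (auto simp: lc_direct_limit_topology_def P_def)
qed

section \<open>Complete topological groups\<close>

definition topological_group :: "('g, 'm) monoid_scheme \<Rightarrow> 'g topology \<Rightarrow> bool" where
  "topological_group G T \<longleftrightarrow>
     group G \<and> topspace T = carrier G \<and>
     continuous_map (prod_topology T T) T (\<lambda>(x, y). x \<otimes>\<^bsub>G\<^esub> y) \<and>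
     continuous_map T T (m_inv G)"

definition directed_preorder :: "'i set \<Rightarrow> ('i \<Rightarrow> 'i \<Rightarrow> bool) \<Rightarrow> bool" where
  "directed_preorder I leq \<longleftrightarrow>
     I \<noteq> {} \<and> (\<forall>\<alpha>\<in>I. leq \<alpha> \<alpha>) \<and>
     (\<forall>\<alpha>\<in>I. \<forall>\<beta>\<in>I. \<forall>\<gamma>\<in>I. leq \<alpha> \<beta> \<and> leq \<beta> \<gamma> \<longrightarrow> leq \<alpha> \<gamma>) \<and>
     (\<forall>\<alpha>\<in>I. \<forall>\<beta>\<in>I. \<exists>\<gamma>\<in>I. leq \<alpha> \<gamma> \<and> leq \<beta> \<gamma>)"

definition left_Cauchy_net ::
    "('g, 'm) monoid_scheme \<Rightarrow> 'g topology \<Rightarrow> 'i set \<Rightarrow> ('i \<Rightarrow> 'i \<Rightarrow> bool) \<Rightarrow> ('i \<Rightarrow> 'g) \<Rightarrow> bool" where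
  "left_Cauchy_net G T I leq x \<longleftrightarrow>
     x ` I \<subseteq> carrier G \<and>
     (\<forall>U. openin T U \<and> \<one>\<^bsub>G\<^esub> \<in> U \<longrightarrow>
        (\<exists>\<gamma>\<in>I. \<forall>\<alpha>\<in>I. \<forall>\<beta>\<in>I. leq \<gamma> \<alpha> \<and> leq \<gamma> \<beta> \<longrightarrow> m_inv G (x \<beta>) \<otimes>\<^bsub>G\<^esub> x \<alpha> \<in> U))"

definition net_converges_to ::
    "'g topology \<Rightarrow> 'i set \<Rightarrow> ('i \<Rightarrow> 'i \<Rightarrow> bool) \<Rightarrow> ('i \<Rightarrow> 'g) \<Rightarrow> 'g \<Rightarrow> bool" where
  "net_converges_to T I leq x l \<longleftrightarrow>
     l \<in> topspace T \<and>
     (\<forall>U. openin T U \<and> l \<in> U \<longrightarrow> (\<exists>\<gamma>\<in>I. \<forall>\<alpha>\<in>I. leq \<gamma> \<alpha> \<longrightarrow> x \<alpha> \<in> U))"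

text \<open>
  A formula cannot quantify over types, so the type \<open>'i\<close> from which index sets of nets are
  taken is a parameter.  In a theorem it should be a type variable, and then nets with
  arbitrary index sets are covered.
\<close>

definition complete_topological_group ::
    "'i itself \<Rightarrow> ('g, 'm) monoid_scheme \<Rightarrow> 'g topology \<Rightarrow> bool" where
  "complete_topological_group (_ :: 'i itself) G T \<longleftrightarrow>
     topological_group G T \<and>
     (\<forall>(I :: 'i set) leq x. directed_preorder I leq \<and> left_Cauchy_net G T I leq x \<longrightarrow>
        (\<exists>l. net_converges_to T I leq x l))"

definition unit_group :: "'a::monoid_mult monoid" where
  "unit_group = units_of \<lparr>carrier = UNIV, mult = (*), one = 1\<rparr>"

lemma carrier_unit_group: "carrier unit_group = {x. \<exists>y. y * x = 1 \<and> x * y = 1}"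
  by (simp add: unit_group_def units_of_def Units_def)

end

theory Submission
  imports Defs
begin

text \<open>The sets of finite sums \<open>\<Sum>i<N. x i\<close> with \<open>x i \<in> A i\<close> and \<open>\<nu> i (x i) < \<epsilon> i\<close> form a basis of
  neighbourhoods of zero in the locally convex direct limit. Inverting the partial sums of
  \<open>1 + \<Sum>i. x i\<close> one after the other, each by a Neumann series in the step it lies in, shows
  that inversion is continuous and that elements close to 1 factor, for every \<open>n\<close>, into a unit
  of \<open>A n\<close> and an element whose closeness to 1 may be prescribed depending on \<open>n\<close>. As in the
  proof that strict inductive limits of Banach spaces are complete, such a factorization forces
  a left Cauchy net to come arbitrarily close, cofinally, to the units of one fixed \<open>A n\<close>. By
  strictness, \<open>A n\<close> carries the topology of its norm, so the approximating units of \<open>A n\<close>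
  contain a left Cauchy sequence for the norm. It converges to a unit of \<open>A n\<close>, which is the
  limit of the net.\<close>

section \<open>Banach algebras\<close>

text \<open>Two orders of choice shape the proof. For inversion, the radius allowed for the summand
  \<open>x n\<close> must be fixed in advance, yet it has to be small relative to the inverse of a
  partial sum that is not yet known; prescribing how far each summand may move the inverse bounds
  all these inverses beforehand. For Cauchy nets, the step \<open>A n\<close> that contains
  \<open>x \<beta>\<close> and its inverse is known only once \<open>\<beta>\<close> is chosen, and
  \<open>\<beta>\<close> is chosen from the neighbourhood of 1; hence one neighbourhood has to serve
  every \<open>n\<close>. This is possible because the summand with index \<open>i\<close> is
  constrained only by the finitely many \<open>n \<le> i\<close>. The limit need not have a
  countable base of neighbourhoods of 1, so the sequence extracted from the net only locates the
  limit; convergence is then proved for each neighbourhood separately.\<close>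

context unital_Banach_algebra
begin

lemma diff_mem: "x \<in> S \<Longrightarrow> y \<in> S \<Longrightarrow> x - y \<in> S"
  and add_mem: "x \<in> S \<Longrightarrow> y \<in> S \<Longrightarrow> x + y \<in> S"
  and zero_mem: "0 \<in> S"
  and sum_mem: "(\<And>i. i \<in> I \<Longrightarrow> f i \<in> S) \<Longrightarrow> sum f I \<in> S"
  and scale_mem: "x \<in> S \<Longrightarrow> smul c x \<in> S"
  using subspace by (auto intro: subspace_diff subspace_add subspace_0 subspace_sum subspace_scale)

lemma norm_zero: "\<nu> 0 = 0"
  using norm_eq_zero [OF zero_mem] by simp

lemma norm_minus_commute: "x \<in> S \<Longrightarrow> y \<in> S \<Longrightarrow> \<nu> (x - y) = \<nu> (y - x)"
  using norm_scale [OF diff_mem, of x y "- 1"] by simp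

lemma norm_triangle_diff:
  "\<lbrakk>x \<in> S; y \<in> S; z \<in> S\<rbrakk> \<Longrightarrow> \<nu> (x - z) \<le> \<nu> (x - y) + \<nu> (y - z)"
  using norm_triangle [OF diff_mem diff_mem, of x y y z] by simp

lemma norm_sum:
  assumes "\<And>i. i \<in> I \<Longrightarrow> f i \<in> S"
  shows "\<nu> (sum f I) \<le> (\<Sum>i\<in>I. \<nu> (f i))"
  using assms
proof (induction I rule: infinite_finite_induct)
  case (insert i I)
  then show ?case
    using norm_triangle [of "f i" "sum f I"] sum_mem [of I f] by fastforce
qed (simp_all add: norm_zero)

lemma openin_norm_topology:
  "openin (norm_topology S \<nu>) U \<longleftrightarrow>
     U \<subseteq> S \<and> (\<forall>x\<in>U. \<exists>r>0. \<forall>y\<in>S. \<nu> (y - x) < r \<longrightarrow> y \<in> U)"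
proof -
  interpret M: Metric_space S "norm_dist S \<nu>" by (rule Metric_space_norm_dist)
  have "M.mball x r \<subseteq> U \<longleftrightarrow> (\<forall>y\<in>S. \<nu> (y - x) < r \<longrightarrow> y \<in> U)" if "x \<in> S" for x r
    using that by (auto simp: subset_iff norm_dist_def norm_minus_commute [of x])
  then show ?thesis
    unfolding norm_topology_def M.openin_mtopology by (meson subset_iff)
qed

lemma openin_norm_ball: "openin (norm_topology S \<nu>) {x \<in> S. \<nu> x < r}"
  unfolding openin_norm_topology
proof (intro conjI ballI)
  fix x assume x: "x \<in> {x \<in> S. \<nu> x < r}"
  have "\<nu> y < r" if "y \<in> S" "\<nu> (y - x) < r - \<nu> x" for y
    using norm_triangle [of "y - x" x] that x diff_mem by force
  then show "\<exists>d>0. \<forall>y\<in>S. \<nu> (y - x) < d \<longrightarrow> y \<in> {x \<in> S. \<nu> x < r}"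
    using x by (intro exI [of _ "r - \<nu> x"]) auto
qed auto

lemma Cauchy_convergent:
  assumes mem: "\<And>n. s n \<in> S"
    and Cauchy: "\<And>e. e > 0 \<Longrightarrow> \<exists>N. \<forall>m\<ge>N. \<forall>n\<ge>m. \<nu> (s n - s m) < e"
  obtains l where "l \<in> S" "(\<lambda>n. \<nu> (s n - l)) \<longlonglongrightarrow> 0"
proof -
  interpret M: Metric_space S "norm_dist S \<nu>" by (rule Metric_space_norm_dist)
  have "M.MCauchy s"
    unfolding M.MCauchy_def
  proof (intro conjI allI impI)
    show "range s \<subseteq> S" using mem by auto
    fix e :: real assume "e > 0"
    then obtain N where N: "\<forall>m\<ge>N. \<forall>n\<ge>m. \<nu> (s n - s m) < e" using Cauchy by blast
    then have "\<nu> (s n - s m) < e" if "N \<le> n" "N \<le> m" for m n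
      using that norm_minus_commute [OF mem mem, of m n] by (metis nle_le)
    then show "\<exists>N. \<forall>n n'. N \<le> n \<longrightarrow> N \<le> n' \<longrightarrow> norm_dist S \<nu> (s n) (s n') < e"
      using mem by (auto simp: norm_dist_def)
  qed
  then obtain l where l: "limitin M.mtopology s l sequentially"
    using complete M.mcomplete_def by blast
  then have "l \<in> S" by (simp add: M.limit_metric_sequentially)
  moreover have "(\<lambda>n. \<nu> (s n - l)) \<longlonglongrightarrow> 0"
  proof (rule LIMSEQ_I)
    fix e :: real assume "e > 0"
    then obtain N where "\<forall>n\<ge>N. norm_dist S \<nu> (s n) l < e"
      using l by (meson M.limit_metric_sequentially)
    then have "\<forall>n\<ge>N. norm (\<nu> (s n - l) - 0) < e"
      using mem \<open>l \<in> S\<close> by (auto simp: norm_dist_def norm_nonneg diff_mem)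
    then show "\<exists>N. \<forall>n\<ge>N. norm (\<nu> (s n - l) - 0) < e" ..
  qed
  ultimately show thesis using that by blast
qed

text \<open>The Neumann series in abstract form: each application of \<open>f\<close> halves the
  distance between iterates of \<open>x \<mapsto> u + f x\<close>. Keeping \<open>f\<close> abstract
  lets one argument serve left and right multiplication, hence both one-sided inverses.\<close>

lemma additive_contraction_solution:
  assumes f_mem: "\<And>x. x \<in> S \<Longrightarrow> f x \<in> S"
    and f_diff: "\<And>x y. x \<in> S \<Longrightarrow> y \<in> S \<Longrightarrow> f (x - y) = f x - f y"
    and f_norm: "\<And>x. x \<in> S \<Longrightarrow> \<nu> (f x) \<le> \<nu> x / 2"
    and u: "u \<in> S"
  obtains b where "b \<in> S" "b = u + f b"
proof -
  define s where "s n = ((\<lambda>x. u + f x) ^^ n) 0" for n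
  have s_Suc: "s (Suc n) = u + f (s n)" for n by (simp add: s_def)
  have mem: "s n \<in> S" for n
    by (induction n) (auto simp: s_Suc f_mem u add_mem, simp add: s_def zero_mem)
  \<comment> \<open>This is the case \<open>n = 0\<close> of the Cauchy estimate below, since
    \<open>s 0 = 0\<close>.\<close>
  have bound: "\<nu> (s n) \<le> 2 * \<nu> u" for n
  proof (induction n)
    case (Suc n)
    then show ?case
      using norm_triangle [OF u f_mem [OF mem], of n] f_norm [OF mem, of n] by (simp add: s_Suc)
  qed (simp add: s_def norm_zero norm_nonneg u)
  have Cauchy: "\<nu> (s (n + k) - s n) \<le> 2 * \<nu> u / 2 ^ n" for n k
  proof (induction n)
    case 0
    then show ?case using bound by (simp add: s_def)
  next
    case (Suc n)
    have "s (Suc n + k) - s (Suc n) = f (s (n + k) - s n)"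
      by (simp add: s_Suc f_diff mem)
    then show ?case
      using f_norm [OF diff_mem [OF mem mem], of "n + k" n] Suc by simp
  qed
  have small: "(\<lambda>n. 2 * \<nu> u / 2 ^ n) \<longlonglongrightarrow> 0"
    using LIMSEQ_divide_realpow_zero [of 2 "2 * \<nu> u"] by simp
  obtain l where l: "l \<in> S" "(\<lambda>n. \<nu> (s n - l)) \<longlonglongrightarrow> 0"
  proof (rule Cauchy_convergent [of s])
    fix e :: real assume "e > 0"
    then have "\<forall>\<^sub>F n in sequentially. 2 * \<nu> u / 2 ^ n < e"
      using small order_tendstoD(2) by blast
    then show "\<exists>N. \<forall>m\<ge>N. \<forall>n\<ge>m. \<nu> (s n - s m) < e"
      unfolding eventually_sequentially
      by (metis Cauchy le_iff_add order_le_less_trans)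
  qed (use mem in auto)
  have "\<nu> (l - (u + f l)) \<le> \<nu> (s (Suc n) - l) + \<nu> (s n - l)" for n
  proof -
    have "s (Suc n) - (u + f l) = f (s n - l)" by (simp add: s_Suc f_diff mem l)
    then have "\<nu> (s (Suc n) - (u + f l)) \<le> \<nu> (s n - l)"
      using f_norm [OF diff_mem [OF mem l(1)], of n] norm_nonneg [OF diff_mem [OF mem l(1)], of n]
      by simp
    then show ?thesis
      using norm_triangle_diff [of l "s (Suc n)" "u + f l"] norm_minus_commute [of l "s (Suc n)"]
        mem l(1) u f_mem add_mem by fastforce
  qed
  moreover have "(\<lambda>n. \<nu> (s (Suc n) - l) + \<nu> (s n - l)) \<longlonglongrightarrow> 0 + 0"
    by (intro tendsto_add l(2) LIMSEQ_Suc)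
  ultimately have "\<nu> (l - (u + f l)) \<le> 0"
    by (intro LIMSEQ_le_const) auto
  then have "l - (u + f l) = 0"
    using norm_nonneg norm_eq_zero l(1) u f_mem add_mem diff_mem by (metis order_antisym)
  then show thesis using that l(1) by simp
qed

lemma Neumann:
  assumes a: "a \<in> S" "\<nu> a \<le> 1 / 2"
  obtains b where "b \<in> S" "(1 + a) * b = 1" "b * (1 + a) = 1" "\<nu> (b - 1) \<le> 2 * \<nu> a"
proof -
  have half: "\<nu> a * \<nu> x \<le> \<nu> x / 2" if "x \<in> S" for x
    using a mult_right_mono [of "\<nu> a" "1/2" "\<nu> x"] norm_nonneg [OF that] by simp
  have neg: "- x \<in> S" "\<nu> (- x) = \<nu> x" if "x \<in> S" for x
    using diff_mem [OF zero_mem that] norm_minus_commute [OF zero_mem that] by auto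
  obtain b where b: "b \<in> S" "b = 1 + - (a * b)"
  proof (rule additive_contraction_solution [where f = "\<lambda>x. - (a * x)" and u = 1])
    show "\<nu> (- (a * x)) \<le> \<nu> x / 2" if "x \<in> S" for x
      using norm_mult [OF a(1) that] half [OF that] neg mult_mem a that by force
  qed (use a neg mult_mem one_mem in \<open>auto simp: algebra_simps\<close>)
  obtain c where c: "c \<in> S" "c = 1 + - (c * a)"
  proof (rule additive_contraction_solution [where f = "\<lambda>x. - (x * a)" and u = 1])
    show "\<nu> (- (x * a)) \<le> \<nu> x / 2" if "x \<in> S" for x
      using norm_mult [OF that a(1)] half [OF that] neg mult_mem a that by (force simp: mult.commute)
  qed (use a neg mult_mem one_mem in \<open>auto simp: algebra_simps\<close>)
  have ab: "(1 + a) * b = 1" and ca: "c * (1 + a) = 1"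
    using b(2) c(2) by (simp_all add: algebra_simps)
  have "c = b" using ab ca by (metis mult.assoc mult_1_left mult_1_right)
  \<comment> \<open>Isolating \<open>b - 1\<close> keeps \<open>\<nu> 1\<close> out of the estimate:
    half of \<open>\<nu> (b - 1)\<close> is moved to the left, which gives the factor 2.\<close>
  have "b - 1 = - (a + a * (b - 1))" using ab by (simp add: algebra_simps)
  then have "\<nu> (b - 1) = \<nu> (a + a * (b - 1))"
    using neg a b one_mem add_mem mult_mem diff_mem by metis
  also have "\<dots> \<le> \<nu> a + \<nu> (b - 1) / 2"
    using norm_triangle [of a "a * (b - 1)"] norm_mult [of a "b - 1"] half [of "b - 1"]
      a b one_mem mult_mem diff_mem by fastforce
  finally have "\<nu> (b - 1) \<le> 2 * \<nu> a" by simp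
  then show thesis using that ab ca \<open>c = b\<close> b by blast
qed

text \<open>Since \<open>y + x = y * (1 + w * x)\<close>, a Neumann inverse of the second factor
  suffices. The point is the uniformity: the radius depends on a bound for the inverse
  \<open>w\<close>, not on \<open>y\<close> itself.\<close>

lemma inverse_perturbation:
  assumes M: "M > 0" and \<eta>: "\<eta> > 0"
  obtains \<delta> where "\<delta> > 0"
    "\<And>x y w. \<lbrakk>x \<in> S; \<nu> x < \<delta>; w \<in> S; \<nu> w \<le> M; y * w = 1; w * y = 1\<rbrakk>
       \<Longrightarrow> \<exists>w'. (y + x) * w' = 1 \<and> w' * (y + x) = 1 \<and> w' - w \<in> S \<and> \<nu> (w' - w) < \<eta>"
proof
  \<comment> \<open>The first bound gives \<open>\<nu> (w * x) \<le> 1 / 2\<close>; the second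
    brings \<open>2 * (M * \<nu> x) * M\<close>, which bounds the change of the inverse, below
    \<open>\<eta>\<close>.\<close>
  define \<delta> where "\<delta> = min (1 / (2 * M)) (\<eta> / (2 * M * M))"
  show "\<delta> > 0" using M \<eta> by (simp add: \<delta>_def)
  fix x y w assume x: "x \<in> S" "\<nu> x < \<delta>" and w: "w \<in> S" "\<nu> w \<le> M" "y * w = 1" "w * y = 1"
  have le: "\<nu> (w * x) \<le> M * \<nu> x"
    using norm_mult [OF w(1) x(1)] mult_right_mono [OF w(2) norm_nonneg [OF x(1)]] by simp
  have "M * \<nu> x \<le> 1 / 2"
    using x(2) M by (simp add: \<delta>_def field_simps)
  then obtain b where b: "b \<in> S" "(1 + w * x) * b = 1" "b * (1 + w * x) = 1"
      "\<nu> (b - 1) \<le> 2 * \<nu> (w * x)"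
    using Neumann [of "w * x"] le x w mult_mem by force
  have yx: "y + x = y * (1 + w * x)"
    using w(3) by (simp add: distrib_left mult.assoc [symmetric])
  have "(y + x) * (b * w) = y * ((1 + w * x) * b) * w" by (simp only: yx mult.assoc)
  moreover have "b * w * (y + x) = b * (w * y) * (1 + w * x)" by (simp only: yx mult.assoc)
  moreover have diff: "b * w - w = (b - 1) * w" by (simp add: algebra_simps)
  moreover have "\<nu> ((b - 1) * w) < \<eta>"
  proof -
    have "\<nu> ((b - 1) * w) \<le> \<nu> (b - 1) * \<nu> w"
      by (rule norm_mult) (use b w one_mem diff_mem in auto)
    also have "\<dots> \<le> (2 * (M * \<nu> x)) * M"
      using b(4) le w(2) M norm_nonneg x(1) by (intro mult_mono) (auto simp: w)
    also have "\<dots> = \<nu> x * (2 * M * M)" by simp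
    also have "\<dots> < \<eta>" using x(2) M by (simp add: \<delta>_def field_simps)
    finally show ?thesis .
  qed
  ultimately show "\<exists>w'. (y + x) * w' = 1 \<and> w' * (y + x) = 1 \<and> w' - w \<in> S \<and> \<nu> (w' - w) < \<eta>"
    using b w one_mem diff_mem mult_mem by (intro exI [of _ "b * w"]) auto
qed

text \<open>All terms from index 1 on lie in the translate of a neighbourhood of 1 consisting of
  units, hence so does the limit.\<close>

lemma left_Cauchy_units_converge:
  assumes mem: "\<And>k. a k \<in> S" "\<And>k. a' k \<in> S"
    and inv: "\<And>k. a k * a' k = 1" "\<And>k. a' k * a k = 1"
    and Cauchy: "\<And>k m. k \<le> m \<Longrightarrow> \<nu> (a' k * a m - 1) < 1 / real (Suc k)"
  obtains l l' where "l \<in> S" "l' \<in> S" "l * l' = 1" "l' * l = 1"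
    "\<And>k. k \<ge> 1 \<Longrightarrow> \<nu> (l' * a k - 1) \<le> 2 / real (Suc k)"
proof -
  \<comment> \<open>From \<open>a m = a 0 * (a' 0 * a m)\<close>, where the second factor is within
    distance 1 of 1; the added 1 makes \<open>C\<close> positive.\<close>
  define C where "C = \<nu> (a 0) * (1 + \<nu> 1) + 1"
  have C0: "C > 0"
    unfolding C_def using norm_nonneg [OF mem(1), of 0] norm_nonneg [OF one_mem]
    by (smt (verit) mult_nonneg_nonneg)
  have bound: "\<nu> (a m) \<le> C" for m
  proof -
    have "a m = a 0 * (a' 0 * a m)" by (simp add: mult.assoc [symmetric] inv)
    then have "\<nu> (a m) \<le> \<nu> (a 0) * \<nu> (a' 0 * a m)"
      using norm_mult [of "a 0" "a' 0 * a m"] mem mult_mem by metis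
    also have "\<nu> (a' 0 * a m) \<le> \<nu> (a' 0 * a m - 1) + \<nu> 1"
      using norm_triangle [of "a' 0 * a m - 1" 1] mem mult_mem one_mem diff_mem by simp
    also have "\<dots> \<le> 1 + \<nu> 1" using Cauchy [of 0 m] by simp
    finally show ?thesis
      using norm_nonneg [OF mem(1), of 0] by (simp add: C_def mult_left_mono)
  qed
  have diff: "\<nu> (a m - a k) \<le> C * (1 / real (Suc k))" if "k \<le> m" for k m
  proof -
    have "a m - a k = a k * (a' k * a m - 1)"
      by (simp add: right_diff_distrib mult.assoc [symmetric] inv)
    then have "\<nu> (a m - a k) \<le> \<nu> (a k) * \<nu> (a' k * a m - 1)"
      using norm_mult [of "a k" "a' k * a m - 1"] mem mult_mem one_mem diff_mem by simp
    also have "\<dots> \<le> C * (1 / real (Suc k))"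
      using bound [of k] Cauchy [OF that] mem mult_mem one_mem diff_mem C0
      by (intro mult_mono) (auto simp: norm_nonneg)
    finally show ?thesis .
  qed
  obtain l where l: "l \<in> S" "(\<lambda>n. \<nu> (a n - l)) \<longlonglongrightarrow> 0"
  proof (rule Cauchy_convergent [of a])
    fix e :: real assume "e > 0"
    obtain N where N: "C / e < real N" using reals_Archimedean2 by blast
    have "\<nu> (a n - a m) < e" if "m \<ge> N" "n \<ge> m" for m n
    proof -
      have "C * (1 / real (Suc m)) < e"
        using N \<open>e > 0\<close> that(1) by (simp add: field_simps)
          (smt (verit) mult_left_mono of_nat_mono)
      then show ?thesis using diff [OF that(2)] by linarith
    qed
    then show "\<exists>N. \<forall>m\<ge>N. \<forall>n\<ge>m. \<nu> (a n - a m) < e" by blast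
  qed (use mem in auto)
  \<comment> \<open>Here \<open>k\<close> is fixed while \<open>m\<close> tends to infinity, so the
    factor \<open>\<nu> (a' k)\<close>, for which no bound uniform in \<open>k\<close> is at hand,
    does no harm.\<close>
  have lim: "\<nu> (a' k * l - 1) \<le> 1 / real (Suc k)" for k
  proof (rule LIMSEQ_le_const)
    show "(\<lambda>m. \<nu> (a' k) * \<nu> (a m - l) + 1 / real (Suc k)) \<longlonglongrightarrow> 1 / real (Suc k)"
      using tendsto_add [OF tendsto_mult_left [OF l(2), of "\<nu> (a' k)"] tendsto_const] by simp
    have "\<nu> (a' k * l - 1) \<le> \<nu> (a' k) * \<nu> (a m - l) + 1 / real (Suc k)" if "m \<ge> k" for m
    proof -
      have "\<nu> (a' k * l - 1) \<le> \<nu> (a' k * l - a' k * a m) + \<nu> (a' k * a m - 1)"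
        using norm_triangle_diff mem l(1) one_mem mult_mem by blast
      moreover have "\<nu> (a' k * l - a' k * a m) \<le> \<nu> (a' k) * \<nu> (a m - l)"
        using norm_mult [of "a' k" "l - a m"] norm_minus_commute [of l "a m"] mem l(1) diff_mem
        by (simp add: right_diff_distrib)
      ultimately show ?thesis using Cauchy [OF that] by simp
    qed
    then show "\<exists>N. \<forall>m\<ge>N. \<nu> (a' k * l - 1) \<le> \<nu> (a' k) * \<nu> (a m - l) + 1 / real (Suc k)"
      by blast
  qed
  \<comment> \<open>The restriction to \<open>k \<ge> 1\<close> brings
    \<open>1 / real (Suc k)\<close> below the threshold 1/2 of the Neumann series.\<close>
  have near: "\<exists>b. b \<in> S \<and> (a' k * l) * b = 1 \<and> b * (a' k * l) = 1 \<and> \<nu> (b - 1) \<le> 2 / real (Suc k)"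
    if "k \<ge> 1" for k
  proof -
    have "1 / real (Suc k) \<le> 1 / 2" using that by (simp add: field_simps)
    then have "\<nu> (a' k * l - 1) \<le> 1 / 2" using lim [of k] by linarith
    moreover have "a' k * l - 1 \<in> S" using mem l(1) one_mem mult_mem diff_mem by blast
    ultimately obtain b where "b \<in> S" "(1 + (a' k * l - 1)) * b = 1" "b * (1 + (a' k * l - 1)) = 1"
      "\<nu> (b - 1) \<le> 2 * \<nu> (a' k * l - 1)"
      using Neumann by blast
    then show ?thesis using lim [of k] by (intro exI [of _ b]) auto
  qed
  obtain b where b: "b \<in> S" "(a' 1 * l) * b = 1" "b * (a' 1 * l) = 1" using near [of 1] by blast
  define l' where "l' = b * a' 1"
  have l'l: "l' * l = 1" using b by (simp add: l'_def mult.assoc)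
  have "l * b = a 1 * ((a' 1 * l) * b)" by (simp only: mult.assoc [symmetric] inv mult_1_left)
  then have "l * b = a 1" using b by simp
  then have "l * l' = 1" by (simp only: l'_def mult.assoc [symmetric] inv)
  moreover have "\<nu> (l' * a k - 1) \<le> 2 / real (Suc k)" if k: "k \<ge> 1" for k
  proof -
    obtain c where c: "(a' k * l) * c = 1" "\<nu> (c - 1) \<le> 2 / real (Suc k)"
      using near [OF k] by blast
    \<comment> \<open>\<open>l' * a k\<close> is the inverse of \<open>a' k * l\<close>, and that
      inverse is close to 1 by \<open>near\<close>.\<close>
    have "l' * a k = l' * a k * ((a' k * l) * c)" using c by simp
    also have "\<dots> = l' * (a k * a' k) * l * c" by (simp only: mult.assoc)
    also have "\<dots> = c" by (simp add: inv l'l)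
    finally show ?thesis using c by simp
  qed
  moreover have "l' \<in> S" using b mem mult_mem by (simp add: l'_def)
  ultimately show thesis using that l(1) l'l by blast
qed

end

section \<open>Strict sequences of Banach algebras\<close>

abbreviation pos :: "(nat \<Rightarrow> real) \<Rightarrow> bool" where
  "pos \<epsilon> \<equiv> \<forall>i. 0 < \<epsilon> i"

text \<open>Strictness is encoded by requiring the norms of the steps to be equivalent wherever both
  are meaningful, with comparison constants \<open>K\<close>.\<close>

locale strict_Banach_algebra_sequence =
  fixes smul :: "'k::real_normed_field \<Rightarrow> 'a::{ring, monoid_mult} \<Rightarrow> 'a"
    and A :: "nat \<Rightarrow> 'a set"
    and \<nu> :: "nat \<Rightarrow> 'a \<Rightarrow> real"
    and K :: "nat \<Rightarrow> nat \<Rightarrow> real"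
  assumes Banach: "unital_Banach_algebra smul (A n) (\<nu> n)"
    and ascending: "A n \<subseteq> A (Suc n)"
    and union: "(\<Union>n. A n) = UNIV"
    and K_pos: "0 < K i j"
    and norm_le: "\<lbrakk>x \<in> A i; x \<in> A j\<rbrakk> \<Longrightarrow> \<nu> j x \<le> K i j * \<nu> i x"
begin

sublocale unital_algebra smul
  using Banach [of 0] by (simp add: unital_Banach_algebra_def)

lemmas A_mult = unital_Banach_algebra.mult_mem [OF Banach]
  and A_one = unital_Banach_algebra.one_mem [OF Banach]
  and A_add = unital_Banach_algebra.add_mem [OF Banach]
  and A_diff = unital_Banach_algebra.diff_mem [OF Banach]
  and A_zero = unital_Banach_algebra.zero_mem [OF Banach]
  and A_sum = unital_Banach_algebra.sum_mem [OF Banach]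
  and A_scale = unital_Banach_algebra.scale_mem [OF Banach]
  and \<nu>_nonneg = unital_Banach_algebra.norm_nonneg [OF Banach]
  and \<nu>_triangle = unital_Banach_algebra.norm_triangle [OF Banach]
  and \<nu>_mult = unital_Banach_algebra.norm_mult [OF Banach]
  and \<nu>_scale = unital_Banach_algebra.norm_scale [OF Banach]
  and \<nu>_zero = unital_Banach_algebra.norm_zero [OF Banach]
  and \<nu>_sum = unital_Banach_algebra.norm_sum [OF Banach]

lemma A_mono: "i \<le> j \<Longrightarrow> x \<in> A i \<Longrightarrow> x \<in> A j"
  using lift_Suc_mono_le [of A, OF ascending] by blast

lemma in_some_A: obtains n where "x \<in> A n"
  using union by blast

text \<open>\<open>n \<le> Suc m\<close> means that the last index \<open>n - 1\<close> is at most
  \<open>m\<close>, so every summand already lies in \<open>A m\<close>, and only constants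
  \<open>K i m\<close> with \<open>i \<le> m\<close> occur in the bound.\<close>

lemma
  assumes "\<And>i. i < n \<Longrightarrow> x i \<in> A i" and "n \<le> Suc m"
  shows partial_sum_mem: "sum x {..<n} \<in> A m"
    and partial_sum_norm: "(\<And>i. i < n \<Longrightarrow> \<nu> i (x i) \<le> c i) \<Longrightarrow>
           \<nu> m (sum x {..<n}) \<le> (\<Sum>i<n. K i m * c i)"
proof -
  have mem: "x i \<in> A m" if "i < n" for i
    using assms that by (meson A_mono less_Suc_eq_le order_less_le_trans)
  then show "sum x {..<n} \<in> A m" by (intro A_sum) auto
  assume c: "\<And>i. i < n \<Longrightarrow> \<nu> i (x i) \<le> c i"
  have "\<nu> m (sum x {..<n}) \<le> (\<Sum>i<n. \<nu> m (x i))" using mem by (intro \<nu>_sum) auto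
  also have "\<dots> \<le> (\<Sum>i<n. K i m * c i)"
  proof (rule sum_mono)
    fix i assume "i \<in> {..<n}"
    then have "\<nu> m (x i) \<le> K i m * \<nu> i (x i)" "\<nu> i (x i) \<le> c i"
      using norm_le mem assms c by auto
    then show "\<nu> m (x i) \<le> K i m * c i"
      using mult_left_mono [of "\<nu> i (x i)" "c i" "K i m"] K_pos [of i m] by linarith
  qed
  finally show "\<nu> m (sum x {..<n}) \<le> (\<Sum>i<n. K i m * c i)" .
qed

subsection \<open>Neighbourhoods of zero\<close>

text \<open>The image of a box neighbourhood of 0 in the direct sum of the \<open>A i\<close> under
  the summation map.\<close>

definition sum_nbhd :: "(nat \<Rightarrow> real) \<Rightarrow> 'a set" where
  "sum_nbhd \<epsilon> = {sum x {..<N} | x N. \<forall>i. x i \<in> A i \<and> \<nu> i (x i) < \<epsilon> i}"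

lemma sum_nbhdI:
  assumes "pos \<epsilon>" "\<And>i. i < N \<Longrightarrow> x i \<in> A i" "\<And>i. i < N \<Longrightarrow> \<nu> i (x i) < \<epsilon> i"
  shows "sum x {..<N} \<in> sum_nbhd \<epsilon>"
proof -
  define y where "y i = (if i < N then x i else 0)" for i
  have "sum x {..<N} = sum y {..<N}" by (simp add: y_def)
  moreover have "\<forall>i. y i \<in> A i \<and> \<nu> i (y i) < \<epsilon> i"
    using assms by (simp add: y_def A_zero \<nu>_zero)
  ultimately show ?thesis unfolding sum_nbhd_def by blast
qed

text \<open>Padding with zeros makes the representation valid for every large upper limit, so that
  two elements can be written as sums of the same length.\<close>

lemma sum_nbhdE:
  assumes "v \<in> sum_nbhd \<epsilon>"
  obtains x N where "\<And>i. x i \<in> A i" "\<And>i. \<nu> i (x i) < \<epsilon> i"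
    "\<And>n. n \<ge> N \<Longrightarrow> v = sum x {..<n}"
proof -
  obtain y N where y: "v = sum y {..<N}" "\<And>i. y i \<in> A i" "\<And>i. \<nu> i (y i) < \<epsilon> i"
    using assms unfolding sum_nbhd_def by blast
  define x where "x i = (if i < N then y i else 0)" for i
  have \<epsilon>: "0 < \<epsilon> i" for i using y(3) [of i] \<nu>_nonneg [OF y(2)] by (meson order_le_less_trans)
  have "v = sum x {..<n}" if "n \<ge> N" for n
    unfolding y(1) by (rule sum.mono_neutral_cong_left) (use that in \<open>auto simp: x_def\<close>)
  moreover have "x i \<in> A i" "\<nu> i (x i) < \<epsilon> i" for i
    using y \<epsilon> by (simp_all add: x_def A_zero \<nu>_zero)
  ultimately show thesis using that by blast
qed

lemma sum_nbhd_mono: "(\<And>i. \<epsilon> i \<le> \<epsilon>' i) \<Longrightarrow> sum_nbhd \<epsilon> \<subseteq> sum_nbhd \<epsilon>'"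
  unfolding sum_nbhd_def by (auto intro: order_less_le_trans)

lemma zero_in_sum_nbhd: "pos \<epsilon> \<Longrightarrow> 0 \<in> sum_nbhd \<epsilon>"
  using sum_nbhdI [of \<epsilon> 0] by simp

lemma step_in_sum_nbhd:
  assumes "pos \<epsilon>" "x \<in> A n" "\<nu> n x < \<epsilon> n"
  shows "x \<in> sum_nbhd \<epsilon>"
  using sum_nbhdI [of \<epsilon> "Suc n" "\<lambda>i. if i = n then x else 0"] assms
  by (simp add: sum.delta A_zero \<nu>_zero)

lemma sum_nbhd_add:
  assumes "u \<in> sum_nbhd \<epsilon>" "v \<in> sum_nbhd \<delta>" "\<And>i. \<epsilon> i + \<delta> i \<le> \<eta> i"
  shows "u + v \<in> sum_nbhd \<eta>"
proof -
  obtain x M where x: "\<And>i. x i \<in> A i" "\<And>i. \<nu> i (x i) < \<epsilon> i"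
    "\<And>n. n \<ge> M \<Longrightarrow> u = sum x {..<n}"
    using sum_nbhdE [OF assms(1)] by blast
  obtain y N where y: "\<And>i. y i \<in> A i" "\<And>i. \<nu> i (y i) < \<delta> i"
    "\<And>n. n \<ge> N \<Longrightarrow> v = sum y {..<n}"
    using sum_nbhdE [OF assms(2)] by blast
  have "\<nu> i (x i + y i) < \<eta> i" for i
    using \<nu>_triangle [OF x(1) y(1), of i] x(2) [of i] y(2) [of i] assms(3) [of i] by linarith
  moreover have "u + v = (\<Sum>i<max M N. x i + y i)"
    using x(3) [of "max M N"] y(3) [of "max M N"] by (simp add: sum.distrib)
  ultimately show ?thesis
    unfolding sum_nbhd_def using A_add x(1) y(1) by blast
qed

lemma sum_nbhd_add_half:
  "u \<in> sum_nbhd (\<lambda>i. \<epsilon> i / 2) \<Longrightarrow> v \<in> sum_nbhd (\<lambda>i. \<epsilon> i / 2) \<Longrightarrow> u + v \<in> sum_nbhd \<epsilon>"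
  by (erule sum_nbhd_add) auto

lemma sum_nbhd_scale:
  assumes "v \<in> sum_nbhd \<epsilon>" "norm c \<le> t" "t > 0"
  shows "smul c v \<in> sum_nbhd (\<lambda>i. t * \<epsilon> i)"
proof -
  obtain x N where x: "\<And>i. x i \<in> A i" "\<And>i. \<nu> i (x i) < \<epsilon> i" "v = sum x {..<N}"
    using assms(1) by (metis sum_nbhdE order_refl)
  have "\<nu> i (smul c (x i)) < t * \<epsilon> i" for i
  proof -
    have "norm c * \<nu> i (x i) \<le> t * \<nu> i (x i)"
      using assms(2) \<nu>_nonneg [OF x(1)] by (simp add: mult_right_mono)
    also have "\<dots> < t * \<epsilon> i" using assms(3) x(2) by simp
    finally show ?thesis by (simp add: \<nu>_scale x(1))
  qed
  moreover have "smul c v = (\<Sum>i<N. smul c (x i))" by (simp add: x(3) scale_sum_right)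
  ultimately show ?thesis
    unfolding sum_nbhd_def using A_scale x(1) by blast
qed

lemma sum_nbhd_absorbing:
  assumes "pos \<epsilon>"
  obtains t where "t > 0" "\<And>c. norm c < t \<Longrightarrow> smul c x \<in> sum_nbhd \<epsilon>"
proof -
  obtain n where n: "x \<in> A n" by (rule in_some_A)
  have \<nu>: "0 < \<nu> n x + 1" using \<nu>_nonneg [OF n] by linarith
  have "smul c x \<in> sum_nbhd \<epsilon>" if "norm c < \<epsilon> n / (\<nu> n x + 1)" for c
  proof (rule step_in_sum_nbhd [OF assms A_scale [OF n]])
    have "norm c * \<nu> n x \<le> norm c * (\<nu> n x + 1)" by (simp add: mult_left_mono)
    also have "\<dots> < \<epsilon> n" using that \<nu> by (simp add: field_simps)
    finally show "\<nu> n (smul c x) < \<epsilon> n" by (simp add: \<nu>_scale n)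
  qed
  then show thesis using that [of "\<epsilon> n / (\<nu> n x + 1)"] assms \<nu> by simp
qed

lemma sum_nbhd_open:
  assumes "v \<in> sum_nbhd \<epsilon>"
  obtains \<delta> where "pos \<delta>" "\<And>u. u \<in> sum_nbhd \<delta> \<Longrightarrow> v + u \<in> sum_nbhd \<epsilon>"
proof -
  obtain x N where x: "\<And>i. x i \<in> A i" "\<And>i. \<nu> i (x i) < \<epsilon> i"
    "\<And>n. n \<ge> N \<Longrightarrow> v = sum x {..<n}"
    using sum_nbhdE [OF assms] by blast
  \<comment> \<open>Half of the slack left by the strict inequalities keeps the summands of
    \<open>v\<close> strictly below their enlarged radii; the other half is given to
    \<open>u\<close>.\<close>
  define \<delta> where "\<delta> i = (\<epsilon> i - \<nu> i (x i)) / 2" for i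
  have "v + u \<in> sum_nbhd \<epsilon>" if "u \<in> sum_nbhd \<delta>" for u
  proof (rule sum_nbhd_add [OF _ that])
    show "v \<in> sum_nbhd (\<lambda>i. \<nu> i (x i) + \<delta> i)"
      unfolding sum_nbhd_def using x by (auto simp: \<delta>_def intro!: exI [of _ x] exI [of _ N])
  qed (auto simp: \<delta>_def field_simps)
  moreover have "pos \<delta>" using x(2) by (simp add: \<delta>_def)
  ultimately show thesis using that by blast
qed

text \<open>The product of two sums is regrouped by the larger index: \<open>z m\<close> collects
  the products of summands whose larger index is \<open>m\<close>, all of which lie in
  \<open>A m\<close>. Capping the radii at 1 bounds the partial sums in advance, so
  \<open>\<delta> m\<close> can be chosen without knowing the other radii.\<close>

lemma sum_nbhd_mult:
  assumes "pos \<epsilon>"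
  obtains \<delta> where "pos \<delta>" "\<And>u v. u \<in> sum_nbhd \<delta> \<Longrightarrow> v \<in> sum_nbhd \<delta> \<Longrightarrow> u * v \<in> sum_nbhd \<epsilon>"
proof -
  define Q where "Q m = (\<Sum>i<Suc m. K i m)" for m
  \<comment> \<open>The norm of \<open>z m\<close> is at most \<open>2 * Q m * \<delta> m\<close>;
    the additional 1 makes the final inequality strict.\<close>
  define \<delta> where "\<delta> m = min 1 (\<epsilon> m / (2 * Q m + 1))" for m
  have Q: "0 \<le> Q m" for m unfolding Q_def by (simp add: sum_nonneg K_pos less_imp_le)
  have \<delta>: "pos \<delta>" using assms Q by (simp add: \<delta>_def add_nonneg_pos)
  have bound: "sum x {..<n} \<in> A m" "\<nu> m (sum x {..<n}) \<le> Q m"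
    if "\<And>i. x i \<in> A i" "\<And>i. \<nu> i (x i) < \<delta> i" "n \<le> Suc m" for x n m
  proof -
    show "sum x {..<n} \<in> A m" using that by (intro partial_sum_mem) auto
    have "\<nu> i (x i) \<le> 1" for i using that(2) [of i] by (simp add: \<delta>_def)
    then have "\<nu> m (sum x {..<n}) \<le> (\<Sum>i<n. K i m * 1)"
      using that by (intro partial_sum_norm) auto
    also have "\<dots> \<le> Q m"
      unfolding Q_def mult_1_right using that(3)
      by (intro sum_mono2) (auto simp: K_pos less_imp_le)
    finally show "\<nu> m (sum x {..<n}) \<le> Q m" .
  qed
  have "u * v \<in> sum_nbhd \<epsilon>" if u: "u \<in> sum_nbhd \<delta>" and v: "v \<in> sum_nbhd \<delta>" for u v
  proof -
    obtain x M where x: "\<And>i. x i \<in> A i" "\<And>i. \<nu> i (x i) < \<delta> i"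
      "\<And>n. n \<ge> M \<Longrightarrow> u = sum x {..<n}"
      using sum_nbhdE [OF u] by blast
    obtain y N where y: "\<And>i. y i \<in> A i" "\<And>i. \<nu> i (y i) < \<delta> i"
      "\<And>n. n \<ge> N \<Longrightarrow> v = sum y {..<n}"
      using sum_nbhdE [OF v] by blast
    define z where "z m = sum x {..<Suc m} * y m + x m * sum y {..<m}" for m
    have "z m = sum x {..<Suc m} * sum y {..<Suc m} - sum x {..<m} * sum y {..<m}" for m
      by (simp add: z_def algebra_simps)
    then have "u * v = sum z {..<max M N}"
      using sum_lessThan_telescope [of "\<lambda>m. sum x {..<m} * sum y {..<m}" "max M N"]
        x(3) [of "max M N"] y(3) [of "max M N"] by simp
    moreover have "z m \<in> A m" "\<nu> m (z m) < \<epsilon> m" for m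
    proof -
      have mem: "sum x {..<Suc m} \<in> A m" "sum y {..<m} \<in> A m"
        and le: "\<nu> m (sum x {..<Suc m}) \<le> Q m" "\<nu> m (sum y {..<m}) \<le> Q m"
        using bound [OF x(1,2), of "Suc m" m] bound [OF y(1,2), of m m] by simp_all
      show "z m \<in> A m" unfolding z_def using x y mem by (intro A_add A_mult) auto
      have "\<nu> m (z m) \<le> \<nu> m (sum x {..<Suc m} * y m) + \<nu> m (x m * sum y {..<m})"
        unfolding z_def by (intro \<nu>_triangle A_mult mem x(1) y(1))
      also have "\<nu> m (sum x {..<Suc m} * y m) \<le> Q m * \<delta> m"
        using \<nu>_mult [OF mem(1) y(1)] mult_mono [OF le(1) less_imp_le [OF y(2)] Q \<nu>_nonneg [OF y(1)]]
        by (meson order_trans)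
      also have "\<nu> m (x m * sum y {..<m}) \<le> \<delta> m * Q m"
        using \<nu>_mult [OF x(1) mem(2)] \<delta>
          mult_mono [OF less_imp_le [OF x(2)] le(2) less_imp_le \<nu>_nonneg [OF mem(2)]]
        by (meson order_trans)
      also have "Q m * \<delta> m + \<delta> m * Q m < \<delta> m * (2 * Q m + 1)"
        using \<delta> by (simp add: algebra_simps)
      also have "\<dots> \<le> \<epsilon> m"
      proof -
        have "\<delta> m \<le> \<epsilon> m / (2 * Q m + 1)" by (simp add: \<delta>_def)
        then show ?thesis using Q [of m] by (simp add: pos_le_divide_eq)
      qed
      finally show "\<nu> m (z m) < \<epsilon> m" by simp
    qed
    ultimately show ?thesis unfolding sum_nbhd_def by blast
  qed
  then show thesis using that \<delta> by blast
qed

text \<open>The fixed factor is scaled into a neighbourhood suited to products, and the other factor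
  is scaled by the reciprocal, which leaves the product unchanged.\<close>

lemma sum_nbhd_mult_fixed:
  assumes "pos \<epsilon>"
  obtains \<delta> where "pos \<delta>" "\<And>v. v \<in> sum_nbhd \<delta> \<Longrightarrow> x * v \<in> sum_nbhd \<epsilon>"
    "\<And>v. v \<in> sum_nbhd \<delta> \<Longrightarrow> v * x \<in> sum_nbhd \<epsilon>"
proof -
  obtain \<delta> where \<delta>: "pos \<delta>" "\<And>u v. u \<in> sum_nbhd \<delta> \<Longrightarrow> v \<in> sum_nbhd \<delta> \<Longrightarrow> u * v \<in> sum_nbhd \<epsilon>"
    using sum_nbhd_mult [OF assms] by blast
  obtain t where t: "t > 0" "\<And>c. norm c < t \<Longrightarrow> smul c x \<in> sum_nbhd \<delta>"
    using sum_nbhd_absorbing [OF \<delta>(1)] by blast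
  define s :: real where "s = t / 2"
  have s: "s > 0" "smul (of_real s) x \<in> sum_nbhd \<delta>" using t by (auto simp: s_def)
  have v: "smul (of_real (1 / s)) v \<in> sum_nbhd \<delta>" if "v \<in> sum_nbhd (\<lambda>i. s * \<delta> i)" for v
    using sum_nbhd_scale [OF that, of "of_real (1 / s)" "1 / s"] s(1) by (simp del: of_real_divide)
  have "(of_real s :: 'k) * of_real (1 / s) = 1"
    using s(1) by (metis less_irrefl nonzero_mult_div_cancel_left of_real_1 of_real_mult times_divide_eq_right mult.right_neutral)
  then have "smul (of_real s) x * smul (of_real (1 / s)) v = x * v"
    "smul (of_real (1 / s)) v * smul (of_real s) x = v * x" for v
    by (simp_all add: mult_scale_left mult_scale_right mult.commute)
  then show thesis
    using that [of "\<lambda>i. s * \<delta> i"] \<delta> s v by (metis mult_pos_pos)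
qed

text \<open>An element of \<open>sum_nbhd \<epsilon>\<close> lying in \<open>A n\<close> is estimated by peeling off its last summand
  \<open>x N\<close>, which then lies in \<open>A (N - 1)\<close> and can be absorbed by the preceding summand.\<close>

lemma sum_nbhd_Int_step:
  assumes "r > 0"
  obtains \<epsilon> where "pos \<epsilon>" "\<And>v. v \<in> sum_nbhd \<epsilon> \<Longrightarrow> v \<in> A n \<Longrightarrow> \<nu> n v < r"
proof -
  \<comment> \<open>\<open>D i\<close> is the price of moving the summand \<open>x i\<close> into
    \<open>A n\<close>: one factor \<open>K j (j - 1)\<close> for each step down from
    \<open>j = i\<close> to \<open>j = n + 1\<close>, then the constant \<open>K n n\<close>. For
    \<open>i \<le> n\<close> the product is empty and \<open>K i n\<close> remains.\<close>
  define D where "D i = K (min i n) n * (\<Prod>j\<in>{n<..i}. K j (j - 1))" for i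
  have D_pos: "0 < D i" for i unfolding D_def by (intro mult_pos_pos prod_pos) (auto simp: K_pos)
  have D_le: "D i = K i n" if "i \<le> n" for i using that by (simp add: D_def)
  have D_Suc: "D (Suc i) = D i * K (Suc i) i" if "n \<le> i" for i
  proof -
    have "{n<..Suc i} = insert (Suc i) {n<..i}" using that by auto
    then show ?thesis using that by (simp add: D_def)
  qed
  have est: "\<nu> n (sum x {..<Suc N}) \<le> (\<Sum>i<Suc N. D i * \<nu> i (x i))"
    if "n \<le> N" "\<And>i. x i \<in> A i" "sum x {..<Suc N} \<in> A n" for N x
    using that
  proof (induction N arbitrary: x rule: dec_induct)
    case base
    then have "\<nu> n (sum x {..<Suc n}) \<le> (\<Sum>i<Suc n. K i n * \<nu> i (x i))"
      by (intro partial_sum_norm) auto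
    then show ?case by (simp add: D_le)
  next
    case (step N)
    define y where "y = x(N := x N + x (Suc N))"
    have sums: "sum y {..<Suc N} = sum x {..<Suc (Suc N)}"
      by (simp add: y_def)
    have "sum x {..<Suc (Suc N)} \<in> A N"
      using A_mono [OF step.hyps(1) step.prems(2)] .
    moreover have "sum x {..<Suc N} \<in> A N"
      using step.prems(1) by (intro partial_sum_mem) auto
    \<comment> \<open>The last summand is a difference of two elements of \<open>A N\<close>. For
      the whole sum this rests on its membership in \<open>A n\<close>.\<close>
    ultimately have last: "x (Suc N) \<in> A N"
      using A_diff by (metis add_diff_cancel_left' sum.lessThan_Suc)
    have y: "y i \<in> A i" for i
      using step.prems(1) A_add last by (simp add: y_def)
    \<comment> \<open>The norm of \<open>A N\<close> is estimated by that of the later step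
      \<open>A (Suc N)\<close>; this is the point where strictness is used.\<close>
    have "\<nu> N (x N + x (Suc N)) \<le> \<nu> N (x N) + K (Suc N) N * \<nu> (Suc N) (x (Suc N))"
      using \<nu>_triangle [OF step.prems(1) last] norm_le [OF step.prems(1) last] by linarith
    then have le: "D N * \<nu> N (x N + x (Suc N)) \<le>
        D N * \<nu> N (x N) + D (Suc N) * \<nu> (Suc N) (x (Suc N))"
      using mult_left_mono [OF _ less_imp_le [OF D_pos [of N]]] D_Suc [OF step.hyps(1)]
      by (fastforce simp: algebra_simps)
    have "\<nu> n (sum x {..<Suc (Suc N)}) \<le> (\<Sum>i<Suc N. D i * \<nu> i (y i))"
      using step.IH [OF y] step.prems(2) sums by simp
    also have "\<dots> = (\<Sum>i<N. D i * \<nu> i (x i)) + D N * \<nu> N (x N + x (Suc N))"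
      by (simp add: y_def)
    finally show ?case using le by simp
  qed
  have geometric: "(\<Sum>i<k. r / 2 ^ Suc i) = r * (1 - 1 / 2 ^ k)" for k
    by (induction k) (simp_all add: field_simps)
  \<comment> \<open>Weighted by \<open>D i\<close>, the norms are dominated by a geometric series
    with total \<open>r\<close>, whose finite sums stay strictly below \<open>r\<close>.\<close>
  define \<epsilon> where "\<epsilon> i = r / 2 ^ Suc i / D i" for i
  have "\<nu> n v < r" if v: "v \<in> sum_nbhd \<epsilon>" "v \<in> A n" for v
  proof -
    obtain x N where x: "\<And>i. x i \<in> A i" "\<And>i. \<nu> i (x i) < \<epsilon> i"
      "\<And>n. n \<ge> N \<Longrightarrow> v = sum x {..<n}"
      using sum_nbhdE [OF v(1)] by blast
    \<comment> \<open>Long enough to represent all of \<open>v\<close> and to reach beyond index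
      \<open>n\<close>, as \<open>est\<close> requires.\<close>
    let ?N = "Suc (max n N)"
    have "v = sum x {..<?N}" using x(3) [of ?N] by simp
    then have "\<nu> n v \<le> (\<Sum>i<?N. D i * \<nu> i (x i))"
      using est [of "max n N" x] x(1) v(2) by simp
    also have "\<dots> \<le> (\<Sum>i<?N. r / 2 ^ Suc i)"
    proof (rule sum_mono)
      show "D i * \<nu> i (x i) \<le> r / 2 ^ Suc i" for i
        using x(2) [of i, THEN less_imp_le] D_pos [of i] by (simp only: \<epsilon>_def pos_le_divide_eq mult.commute)
    qed
    also have "\<dots> = r * (1 - 1 / 2 ^ ?N)" by (rule geometric)
    also have "\<dots> < r" using assms by simp
    finally show ?thesis .
  qed
  moreover have "pos \<epsilon>" using assms D_pos by (simp add: \<epsilon>_def)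
  ultimately show thesis using that by blast
qed

subsection \<open>Inverses\<close>

text \<open>The inverses of the partial sums of \<open>1 + \<Sum>i. x i\<close> are constructed successively. The
  bounds \<open>M\<close> depend on \<open>\<eta>\<close> only, which is why \<open>\<delta> n\<close> can be chosen in terms of \<open>M n\<close>.\<close>

lemma inverse_sequence:
  assumes "pos \<eta>"
  obtains M \<delta> where "pos M" "pos \<delta>"
    "\<And>x. (\<And>i. x i \<in> A i) \<Longrightarrow> (\<And>i. \<nu> i (x i) < \<delta> i) \<Longrightarrow>
       \<exists>w. \<forall>n. (1 + sum x {..<n}) * w n = 1 \<and> w n * (1 + sum x {..<n}) = 1 \<and>
             w n - 1 \<in> sum_nbhd \<eta> \<and> (\<forall>m. n \<le> Suc m \<longrightarrow> w n \<in> A m) \<and> (\<forall>m\<ge>n. \<nu> m (w n) \<le> M m)"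
proof -
  \<comment> \<open>\<open>B n m\<close> bounds the norm of \<open>w n\<close> in
    \<open>A m\<close>: the inverse starts at 1, and its change at stage \<open>k\<close> has norm
    below \<open>\<eta> k\<close> in \<open>A k\<close>. The diagonal value \<open>B m m\<close>
    involves only stages before \<open>m\<close>, so it is available when \<open>\<delta> m\<close>
    is chosen; the added 1 in \<open>M\<close> ensures positivity.\<close>
  define B where "B n m = \<nu> m 1 + (\<Sum>k<n. K k m * \<eta> k)" for n m
  define M where "M m = B m m + 1" for m
  have K\<eta>: "0 \<le> K k m * \<eta> k" for k m using K_pos assms by (simp add: less_imp_le)
  have M_pos: "pos M"
    using K\<eta> \<nu>_nonneg [OF A_one] by (simp add: M_def B_def sum_nonneg add_nonneg_pos)
  \<comment> \<open>All inverses \<open>w n\<close> with \<open>n \<le> m\<close> thus share the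
    bound \<open>M m\<close> in \<open>A m\<close>. The inverse \<open>w (Suc m)\<close> also lies
    in \<open>A m\<close>, but this bound does not cover it.\<close>
  have B_le: "B n m \<le> M m" if "n \<le> m" for n m
    using that K\<eta> sum_mono2 [of "{..<m}" "{..<n}" "\<lambda>k. K k m * \<eta> k"] by (simp add: M_def B_def)
  have "\<exists>d>0. \<forall>x y w. x \<in> A n \<and> \<nu> n x < d \<and> w \<in> A n \<and> \<nu> n w \<le> M n \<and> y * w = 1 \<and> w * y = 1 \<longrightarrow>
      (\<exists>w'. (y + x) * w' = 1 \<and> w' * (y + x) = 1 \<and> w' - w \<in> A n \<and> \<nu> n (w' - w) < \<eta> n)" for n
    using unital_Banach_algebra.inverse_perturbation [OF Banach, of "M n" "\<eta> n"] M_pos assms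
    by metis
  then obtain \<delta> where \<delta>: "pos \<delta>" and
    step: "\<And>n x y w. \<lbrakk>x \<in> A n; \<nu> n x < \<delta> n; w \<in> A n; \<nu> n w \<le> M n; y * w = 1; w * y = 1\<rbrakk> \<Longrightarrow>
      \<exists>w'. (y + x) * w' = 1 \<and> w' * (y + x) = 1 \<and> w' - w \<in> A n \<and> \<nu> n (w' - w) < \<eta> n"
    by metis
  have "\<exists>w. \<forall>n. (1 + sum x {..<n}) * w n = 1 \<and> w n * (1 + sum x {..<n}) = 1 \<and>
      w n - 1 \<in> sum_nbhd \<eta> \<and> (\<forall>m. n \<le> Suc m \<longrightarrow> w n \<in> A m) \<and> (\<forall>m\<ge>n. \<nu> m (w n) \<le> M m)"
    if x: "\<And>i. x i \<in> A i" "\<And>i. \<nu> i (x i) < \<delta> i" for x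
  proof -
    define P where "P n w \<longleftrightarrow> (n = 0 \<longrightarrow> w = 1) \<and>
      (1 + sum x {..<n}) * w = 1 \<and> w * (1 + sum x {..<n}) = 1 \<and>
      (\<forall>m. n \<le> Suc m \<longrightarrow> w \<in> A m \<and> \<nu> m w \<le> B n m)" for n w
    define R where "R n w w' \<longleftrightarrow> w' - w \<in> A n \<and> \<nu> n (w' - w) < \<eta> n" for n w w'
    have "\<exists>w. \<forall>n. P n (w n) \<and> R n (w n) (w (Suc n))"
    proof (rule dependent_nat_choice)
      show "\<exists>w. P 0 w" by (auto simp: P_def B_def A_one)
    next
      fix w n assume P: "P n w"
      then have "\<nu> n w \<le> B n n" unfolding P_def by (metis le_SucI order_refl)
      then have "\<nu> n w \<le> M n" using B_le [of n n] by simp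
      then obtain w' where w': "(1 + sum x {..<n} + x n) * w' = 1"
        "w' * (1 + sum x {..<n} + x n) = 1" "w' - w \<in> A n" "\<nu> n (w' - w) < \<eta> n"
        using step [of "x n" n w "1 + sum x {..<n}"] x P by (auto simp: P_def)
      have "w' \<in> A m \<and> \<nu> m w' \<le> B (Suc n) m" if "Suc n \<le> Suc m" for m
      proof -
        have w: "w \<in> A m" "\<nu> m w \<le> B n m" using P that by (auto simp: P_def)
        have d: "w' - w \<in> A m" using w'(3) that A_mono by blast
        have "\<nu> m (w' - w) \<le> K n m * \<eta> n"
          using norm_le [OF w'(3) d] w'(4) K_pos [of n m]
          by (smt (verit) mult_left_mono)
        moreover have "\<nu> m w' \<le> \<nu> m w + \<nu> m (w' - w)" using \<nu>_triangle [OF w(1) d] by simp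
        moreover have "w' \<in> A m" using A_add [OF w(1) d] by simp
        ultimately show ?thesis using w by (simp add: B_def)
      qed
      then show "\<exists>w'. P (Suc n) w' \<and> R n w w'"
        using w' by (auto simp: P_def R_def add.assoc intro!: exI [of _ w'])
    qed
    then obtain w where w: "\<And>n. P n (w n)" "\<And>n. R n (w n) (w (Suc n))" by blast
    have "w n - 1 \<in> sum_nbhd \<eta>" for n
    proof -
      have "w n - 1 = (\<Sum>k<n. w (Suc k) - w k)"
        using sum_lessThan_telescope [of w n] w(1) [of 0] by (simp add: P_def)
      then show ?thesis
        using sum_nbhdI [of \<eta> n "\<lambda>k. w (Suc k) - w k"] assms w(2) by (simp add: R_def)
    qed
    moreover have "\<nu> m (w n) \<le> M m" if "n \<le> m" for n m
      using w(1) [of n] that B_le [OF that] unfolding P_def by (meson le_SucI order_trans)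
    ultimately show ?thesis using w(1) unfolding P_def by (intro exI [of _ w]) blast
  qed
  then show thesis using that [OF M_pos \<delta>] by blast
qed

lemma sum_nbhd_inverse:
  assumes "pos \<epsilon>"
  obtains \<delta> where "pos \<delta>"
    "\<And>v. v \<in> sum_nbhd \<delta> \<Longrightarrow> \<exists>w. (1 + v) * w = 1 \<and> w * (1 + v) = 1 \<and> w - 1 \<in> sum_nbhd \<epsilon>"
proof -
  obtain M \<delta> where \<delta>: "pos \<delta>" and
    w: "\<And>x. (\<And>i. x i \<in> A i) \<Longrightarrow> (\<And>i. \<nu> i (x i) < \<delta> i) \<Longrightarrow>
       \<exists>w. \<forall>n. (1 + sum x {..<n}) * w n = 1 \<and> w n * (1 + sum x {..<n}) = 1 \<and>
             w n - 1 \<in> sum_nbhd \<epsilon> \<and> (\<forall>m. n \<le> Suc m \<longrightarrow> w n \<in> A m) \<and> (\<forall>m\<ge>n. \<nu> m (w n) \<le> M m)"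
    using inverse_sequence [OF assms] by metis
  have "\<exists>w. (1 + v) * w = 1 \<and> w * (1 + v) = 1 \<and> w - 1 \<in> sum_nbhd \<epsilon>" if "v \<in> sum_nbhd \<delta>" for v
    using that w unfolding sum_nbhd_def by blast
  then show thesis using that \<delta> by blast
qed

text \<open>Take for \<open>a\<close> the partial sum of \<open>1 + v\<close> up to index \<open>n\<close>: in the steps beyond \<open>n\<close>, the
  norms of its inverse are bounded by constants depending neither on \<open>v\<close> nor on \<open>n\<close>.\<close>

lemma sum_nbhd_factorization:
  assumes \<epsilon>: "\<And>n. pos (\<epsilon> n)"
  obtains \<delta> where "pos \<delta>"
    "\<And>v n. v \<in> sum_nbhd \<delta> \<Longrightarrow>
       \<exists>a a' u. a \<in> A n \<and> a' \<in> A n \<and> a * a' = 1 \<and> a' * a = 1 \<and> u \<in> sum_nbhd (\<epsilon> n) \<and>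
              1 + v = a * (1 + u)"
proof -
  \<comment> \<open>Here the bounds \<open>M\<close> matter and the distance of the inverses from 1
    does not, hence the constant radii 1.\<close>
  obtain M \<delta> where M: "pos M" and \<delta>: "pos \<delta>" and
    w: "\<And>x. (\<And>i. x i \<in> A i) \<Longrightarrow> (\<And>i. \<nu> i (x i) < \<delta> i) \<Longrightarrow>
       \<exists>w. \<forall>n. (1 + sum x {..<n}) * w n = 1 \<and> w n * (1 + sum x {..<n}) = 1 \<and>
             w n - 1 \<in> sum_nbhd (\<lambda>_. 1) \<and> (\<forall>m. n \<le> Suc m \<longrightarrow> w n \<in> A m) \<and>
             (\<forall>m\<ge>n. \<nu> m (w n) \<le> M m)"
    using inverse_sequence [of "\<lambda>_. 1"] by (metis zero_less_one)
  \<comment> \<open>A summand with index \<open>i\<close> enters the tail of the factorization at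
    \<open>n\<close> only if \<open>n < i\<close>, so finitely many \<open>\<epsilon> n\<close>
    constrain it and their minimum is positive.\<close>
  define \<gamma> where "\<gamma> i = Min ((\<lambda>n. \<epsilon> n i) ` {..i})" for i
  have \<gamma>: "\<gamma> i > 0" for i using \<epsilon> by (auto simp: \<gamma>_def)
  have \<gamma>_le: "\<gamma> i \<le> \<epsilon> n i" if "n \<le> i" for n i using that by (auto simp: \<gamma>_def)
  \<comment> \<open>The division compensates for multiplying the tail by \<open>a'\<close>, whose
    norm in \<open>A i\<close> is at most \<open>M i\<close>.\<close>
  define \<delta>' where "\<delta>' i = min (\<delta> i) (\<gamma> i / M i)" for i
  have "\<exists>a a' u. a \<in> A n \<and> a' \<in> A n \<and> a * a' = 1 \<and> a' * a = 1 \<and> u \<in> sum_nbhd (\<epsilon> n) \<and>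
      1 + v = a * (1 + u)" if v: "v \<in> sum_nbhd \<delta>'" for v n
  proof -
    obtain x N where x: "\<And>i. x i \<in> A i" "\<And>i. \<nu> i (x i) < \<delta>' i"
      "\<And>n. n \<ge> N \<Longrightarrow> v = sum x {..<n}"
      using sum_nbhdE [OF v] by blast
    define a where "a = 1 + sum x {..<Suc n}"
    have "\<nu> i (x i) < \<delta> i" for i using x(2) [of i] by (simp add: \<delta>'_def)
    then obtain a' where a': "a * a' = 1" "a' * a = 1" "a' \<in> A n" "\<And>m. m \<ge> Suc n \<Longrightarrow> a' \<in> A m"
        "\<And>m. m \<ge> Suc n \<Longrightarrow> \<nu> m a' \<le> M m"
      using w [of x] x(1) unfolding a_def by (metis le_SucI order_refl)
    define N' where "N' = max N (Suc n)"
    define z where "z i = (if i < Suc n then 0 else a' * x i)" for i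
    have split: "{..<N'} = {..<Suc n} \<union> {Suc n..<N'}" by (auto simp: N'_def)
    have "v = sum x {..<N'}" using x(3) by (simp add: N'_def)
    also have "\<dots> = sum x {..<Suc n} + sum x {Suc n..<N'}"
      unfolding split by (rule sum.union_disjoint) auto
    finally have v_eq: "1 + v = a + sum x {Suc n..<N'}" by (simp add: a_def add.assoc)
    have "sum z {..<N'} = (\<Sum>i\<in>{Suc n..<N'}. a' * x i)"
      by (rule sum.mono_neutral_cong_right) (auto simp: z_def)
    then have z_sum: "sum z {..<N'} = a' * sum x {Suc n..<N'}" by (simp add: sum_distrib_left)
    have "sum z {..<N'} \<in> sum_nbhd (\<epsilon> n)"
    proof (rule sum_nbhdI [OF \<epsilon>])
      fix i
      show "z i \<in> A i" using a' x(1) A_mult A_zero by (simp add: z_def)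
      show "\<nu> i (z i) < \<epsilon> n i"
      proof (cases "i < Suc n")
        case True
        then show ?thesis using \<epsilon> by (simp add: z_def \<nu>_zero)
      next
        case False
        then have "\<nu> i (a' * x i) \<le> \<nu> i a' * \<nu> i (x i)" using a'(4) x(1) by (intro \<nu>_mult) auto
        also have "\<dots> \<le> M i * \<nu> i (x i)"
          using a'(5) False \<nu>_nonneg [OF x(1)] by (intro mult_right_mono) auto
        also have "\<dots> < M i * (\<gamma> i / M i)"
          using x(2) [of i] M by (intro mult_strict_left_mono) (auto simp: \<delta>'_def)
        also have "\<dots> = \<gamma> i" using M by (metis less_irrefl nonzero_mult_div_cancel_left times_divide_eq_right)
        also have "\<dots> \<le> \<epsilon> n i" using False by (intro \<gamma>_le) auto
        finally show ?thesis using False by (simp add: z_def)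
      qed
    qed
    moreover have "1 + v = a * (1 + sum z {..<N'})"
      by (simp add: v_eq z_sum distrib_left mult.assoc [symmetric] a')
    moreover have "a \<in> A n"
      unfolding a_def using x(1) by (intro A_add A_one partial_sum_mem) auto
    ultimately show ?thesis using a' by blast
  qed
  moreover have "pos \<delta>'" using \<delta> \<gamma> M by (simp add: \<delta>'_def)
  ultimately show thesis using that by blast
qed

subsection \<open>The direct limit topology\<close>

definition limit_topology :: "'a topology" where
  "limit_topology = topology (\<lambda>U. \<forall>x\<in>U. \<exists>\<epsilon>. pos \<epsilon> \<and> (\<forall>v\<in>sum_nbhd \<epsilon>. x + v \<in> U))"

lemma openin_limit_topology:
  "openin limit_topology U \<longleftrightarrow> (\<forall>x\<in>U. \<exists>\<epsilon>. pos \<epsilon> \<and> (\<forall>v\<in>sum_nbhd \<epsilon>. x + v \<in> U))"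
proof -
  let ?P = "\<lambda>U. \<forall>x\<in>U. \<exists>\<epsilon>. pos \<epsilon> \<and> (\<forall>v\<in>sum_nbhd \<epsilon>. x + v \<in> U)"
  have "istopology ?P"
    unfolding istopology_def
  proof (intro conjI allI impI)
    show "?P (U \<inter> V)" if U: "?P U" and V: "?P V" for U V
    proof
      fix x assume "x \<in> U \<inter> V"
      then obtain \<epsilon> \<delta> where "pos \<epsilon>" "\<forall>v\<in>sum_nbhd \<epsilon>. x + v \<in> U" "pos \<delta>" "\<forall>v\<in>sum_nbhd \<delta>. x + v \<in> V"
        using U V by blast
      moreover have "sum_nbhd (\<lambda>i. min (\<epsilon> i) (\<delta> i)) \<subseteq> sum_nbhd \<epsilon> \<inter> sum_nbhd \<delta>"
        using sum_nbhd_mono by simp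
      ultimately show "\<exists>\<epsilon>. pos \<epsilon> \<and> (\<forall>v\<in>sum_nbhd \<epsilon>. x + v \<in> U \<inter> V)"
        by (intro exI [of _ "\<lambda>i. min (\<epsilon> i) (\<delta> i)"]) auto
    qed
    show "?P (\<Union>\<U>)" if "\<forall>U\<in>\<U>. ?P U" for \<U> using that by (meson UnionE UnionI)
  qed
  then show ?thesis by (simp add: limit_topology_def topology_inverse')
qed

lemma openin_translate_sum_nbhd: "openin limit_topology {y. y - x \<in> sum_nbhd \<epsilon>}"
  unfolding openin_limit_topology
proof
  fix y assume "y \<in> {y. y - x \<in> sum_nbhd \<epsilon>}"
  then obtain \<delta> where "pos \<delta>" "\<And>u. u \<in> sum_nbhd \<delta> \<Longrightarrow> y - x + u \<in> sum_nbhd \<epsilon>"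
    using sum_nbhd_open by blast
  then show "\<exists>\<delta>. pos \<delta> \<and> (\<forall>v\<in>sum_nbhd \<delta>. y + v \<in> {y. y - x \<in> sum_nbhd \<epsilon>})"
    by (intro exI [of _ \<delta>]) (simp add: diff_add_eq)
qed

lemma topspace_limit_topology: "topspace limit_topology = UNIV"
proof -
  have "openin limit_topology UNIV"
    unfolding openin_limit_topology by (auto intro: exI [of _ "\<lambda>_. 1"])
  then show ?thesis using openin_subset by blast
qed

lemma continuous_map_binary:
  assumes "\<And>x y \<epsilon>. pos \<epsilon> \<Longrightarrow> \<exists>\<delta>. pos \<delta> \<and>
    (\<forall>u\<in>sum_nbhd \<delta>. \<forall>v\<in>sum_nbhd \<delta>. f (x + u) (y + v) - f x y \<in> sum_nbhd \<epsilon>)"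
  shows "continuous_map (prod_topology limit_topology limit_topology) limit_topology (\<lambda>(x, y). f x y)"
  unfolding continuous_map_def openin_prod_topology_alt
proof (intro conjI allI impI)
  fix U x y assume U: "openin limit_topology U"
    and "(x, y) \<in> {p \<in> topspace (prod_topology limit_topology limit_topology). (case p of (x, y) \<Rightarrow> f x y) \<in> U}"
  then obtain \<epsilon> where \<epsilon>: "pos \<epsilon>" "\<And>v. v \<in> sum_nbhd \<epsilon> \<Longrightarrow> f x y + v \<in> U"
    unfolding openin_limit_topology by auto
  obtain \<delta> where \<delta>: "pos \<delta>"
    "\<And>u v. u \<in> sum_nbhd \<delta> \<Longrightarrow> v \<in> sum_nbhd \<delta> \<Longrightarrow> f (x + u) (y + v) - f x y \<in> sum_nbhd \<epsilon>"
    using assms [OF \<epsilon>(1)] by blast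
  have in_U: "f x' y' \<in> U" if "x' - x \<in> sum_nbhd \<delta>" "y' - y \<in> sum_nbhd \<delta>" for x' y'
    using \<epsilon>(2) [OF \<delta>(2) [OF that]] by simp
  show "\<exists>V W. openin limit_topology V \<and> openin limit_topology W \<and> x \<in> V \<and> y \<in> W \<and>
      V \<times> W \<subseteq> {p \<in> topspace (prod_topology limit_topology limit_topology). (case p of (x, y) \<Rightarrow> f x y) \<in> U}"
  proof (intro exI conjI subsetI)
    show "x \<in> {x'. x' - x \<in> sum_nbhd \<delta>}" "y \<in> {y'. y' - y \<in> sum_nbhd \<delta>}"
      using zero_in_sum_nbhd [OF \<delta>(1)] by simp_all
    fix p assume "p \<in> {x'. x' - x \<in> sum_nbhd \<delta>} \<times> {y'. y' - y \<in> sum_nbhd \<delta>}"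
    then show "p \<in> {p \<in> topspace (prod_topology limit_topology limit_topology). (case p of (x, y) \<Rightarrow> f x y) \<in> U}"
      using in_U by (cases p) (simp add: topspace_limit_topology)
  qed (rule openin_translate_sum_nbhd)+
qed (simp add: topspace_limit_topology)

lemma continuous_map_add:
  "continuous_map (prod_topology limit_topology limit_topology) limit_topology (\<lambda>(x, y). x + y)"
proof (rule continuous_map_binary)
  fix x y :: 'a and \<epsilon> assume "pos \<epsilon>"
  moreover have "x + u + (y + v) - (x + y) = u + v" for u v by simp
  ultimately show "\<exists>\<delta>. pos \<delta> \<and> (\<forall>u\<in>sum_nbhd \<delta>. \<forall>v\<in>sum_nbhd \<delta>. x + u + (y + v) - (x + y) \<in> sum_nbhd \<epsilon>)"
    using sum_nbhd_add_half by (intro exI [of _ "\<lambda>i. \<epsilon> i / 2"]) simp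
qed

lemma continuous_map_mult:
  "continuous_map (prod_topology limit_topology limit_topology) limit_topology (\<lambda>(x, y). x * y)"
proof (rule continuous_map_binary)
  fix x y :: 'a and \<epsilon> assume "pos \<epsilon>"
  then have h: "pos (\<lambda>i. \<epsilon> i / 2)" "pos (\<lambda>i. \<epsilon> i / 2 / 2)" by auto
  obtain \<delta>1 where \<delta>1: "pos \<delta>1"
    "\<And>u v. u \<in> sum_nbhd \<delta>1 \<Longrightarrow> v \<in> sum_nbhd \<delta>1 \<Longrightarrow> u * v \<in> sum_nbhd (\<lambda>i. \<epsilon> i / 2)"
    using sum_nbhd_mult [OF h(1)] by blast
  obtain \<delta>2 where \<delta>2: "pos \<delta>2" "\<And>v. v \<in> sum_nbhd \<delta>2 \<Longrightarrow> x * v \<in> sum_nbhd (\<lambda>i. \<epsilon> i / 2 / 2)"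
    using sum_nbhd_mult_fixed [OF h(2), where x = x] by metis
  obtain \<delta>3 where \<delta>3: "pos \<delta>3" "\<And>v. v \<in> sum_nbhd \<delta>3 \<Longrightarrow> v * y \<in> sum_nbhd (\<lambda>i. \<epsilon> i / 2 / 2)"
    using sum_nbhd_mult_fixed [OF h(2), where x = y] by metis
  define \<delta> where "\<delta> i = min (\<delta>1 i) (min (\<delta>2 i) (\<delta>3 i))" for i
  have sub: "sum_nbhd \<delta> \<subseteq> sum_nbhd \<delta>1" "sum_nbhd \<delta> \<subseteq> sum_nbhd \<delta>2" "sum_nbhd \<delta> \<subseteq> sum_nbhd \<delta>3"
    by (rule sum_nbhd_mono; simp add: \<delta>_def)+
  have "(x + u) * (y + v) - x * y \<in> sum_nbhd \<epsilon>" if "u \<in> sum_nbhd \<delta>" "v \<in> sum_nbhd \<delta>" for u v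
  proof -
    have "(x * v + u * y) + u * v \<in> sum_nbhd \<epsilon>"
      using that sub \<delta>1(2) \<delta>2(2) \<delta>3(2) by (intro sum_nbhd_add_half) blast+
    moreover have "(x + u) * (y + v) - x * y = (x * v + u * y) + u * v" by (simp add: algebra_simps)
    ultimately show ?thesis by simp
  qed
  moreover have "pos \<delta>" using \<delta>1 \<delta>2 \<delta>3 by (simp add: \<delta>_def)
  ultimately show "\<exists>\<delta>. pos \<delta> \<and>
      (\<forall>u\<in>sum_nbhd \<delta>. \<forall>v\<in>sum_nbhd \<delta>. (x + u) * (y + v) - x * y \<in> sum_nbhd \<epsilon>)"
    by blast
qed

lemma continuous_map_scale:
  "continuous_map (prod_topology euclidean limit_topology) limit_topology (\<lambda>(c, x). smul c x)"
  unfolding continuous_map_def openin_prod_topology_alt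
proof (intro conjI allI impI)
  fix U c x assume U: "openin limit_topology U"
    and "(c, x) \<in> {p \<in> topspace (prod_topology euclidean limit_topology). (case p of (c, x) \<Rightarrow> smul c x) \<in> U}"
  then obtain \<epsilon> where \<epsilon>: "pos \<epsilon>" "\<And>v. v \<in> sum_nbhd \<epsilon> \<Longrightarrow> smul c x + v \<in> U"
    unfolding openin_limit_topology by auto
  obtain t where t: "t > 0" "\<And>d. norm d < t \<Longrightarrow> smul d x \<in> sum_nbhd (\<lambda>i. \<epsilon> i / 2)"
    using sum_nbhd_absorbing [of "\<lambda>i. \<epsilon> i / 2"] \<epsilon>(1) by auto
  \<comment> \<open>\<open>s\<close> bounds \<open>norm c'\<close> for every \<open>c'\<close>
    within distance 1 of \<open>c\<close>. The change of the product splits into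
    \<open>smul (c' - c) x\<close> and \<open>smul c' (x' - x)\<close>, each of which is given half
    of \<open>\<epsilon>\<close>.\<close>
  define s where "s = norm c + 1"
  have s: "s > 0" by (simp add: s_def add_nonneg_pos)
  define \<delta> where "\<delta> i = \<epsilon> i / 2 / s" for i
  have \<delta>: "pos \<delta>" using \<epsilon>(1) s by (simp add: \<delta>_def)
  have in_U: "smul c' x' \<in> U" if c': "c' \<in> ball c (min t 1)" and x': "x' - x \<in> sum_nbhd \<delta>" for c' x'
  proof -
    have d: "norm (c' - c) < t" "norm (c' - c) < 1"
      using c' by (auto simp: dist_norm norm_minus_commute)
    have "norm c' \<le> s" using norm_triangle_ineq2 [of c' c] d by (simp add: s_def)
    then have "smul c' (x' - x) \<in> sum_nbhd (\<lambda>i. s * \<delta> i)"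
      using sum_nbhd_scale x' s by blast
    then have "smul c' (x' - x) \<in> sum_nbhd (\<lambda>i. \<epsilon> i / 2)"
      using s by (simp add: \<delta>_def)
    then have "smul (c' - c) x + smul c' (x' - x) \<in> sum_nbhd \<epsilon>"
      using sum_nbhd_add_half t(2) d by blast
    moreover have "smul c x + (smul (c' - c) x + smul c' (x' - x)) = smul c' x'"
      by (simp add: scale_left_diff_distrib scale_right_diff_distrib)
    ultimately show ?thesis using \<epsilon>(2) by metis
  qed
  show "\<exists>V W. openin euclidean V \<and> openin limit_topology W \<and> c \<in> V \<and> x \<in> W \<and>
      V \<times> W \<subseteq> {p \<in> topspace (prod_topology euclidean limit_topology). (case p of (c, x) \<Rightarrow> smul c x) \<in> U}"
  proof (intro exI conjI subsetI)
    show "openin euclidean (ball c (min t 1))" "c \<in> ball c (min t 1)" using t(1) by simp_all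
    show "x \<in> {x'. x' - x \<in> sum_nbhd \<delta>}" using zero_in_sum_nbhd [OF \<delta>] by simp
    fix p assume "p \<in> ball c (min t 1) \<times> {x'. x' - x \<in> sum_nbhd \<delta>}"
    then show "p \<in> {p \<in> topspace (prod_topology euclidean limit_topology). (case p of (c, x) \<Rightarrow> smul c x) \<in> U}"
      using in_U by (cases p) (simp add: topspace_limit_topology)
  qed (rule openin_translate_sum_nbhd)
qed (simp add: topspace_limit_topology)

lemma convex_sum_nbhd: "convex_wrt smul (sum_nbhd \<epsilon>)"
  unfolding convex_wrt_def
proof (intro ballI allI impI)
  fix x y and t :: real
  assume x: "x \<in> sum_nbhd \<epsilon>" and y: "y \<in> sum_nbhd \<epsilon>" and t: "0 \<le> t \<and> t \<le> 1"
  \<comment> \<open>\<open>sum_nbhd_scale\<close> asks for a positive factor, so the endpoints are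
    treated separately.\<close>
  consider "t = 0" | "t = 1" | "0 < t" "t < 1" using t by linarith
  then show "smul (of_real (1 - t)) x + smul (of_real t) y \<in> sum_nbhd \<epsilon>"
  proof cases
    case 3
    show ?thesis
    proof (rule sum_nbhd_add)
      show "smul (of_real (1 - t)) x \<in> sum_nbhd (\<lambda>i. (1 - t) * \<epsilon> i)"
        using 3 by (intro sum_nbhd_scale x) (auto simp del: of_real_diff)
      show "smul (of_real t) y \<in> sum_nbhd (\<lambda>i. t * \<epsilon> i)"
        using 3 by (intro sum_nbhd_scale y) auto
    qed (simp add: algebra_simps)
  qed (use x y in auto)
qed

text \<open>Continuity of addition yields neighbourhoods of 0 such that the sum of two elements of
  \<open>V (Suc n)\<close> lies in \<open>V n\<close>. A finite sum whose term with index
  \<open>i\<close> lies in \<open>V (Suc i)\<close> then stays in \<open>V 0\<close>, and radii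
  fitted to these neighbourhoods keep \<open>x + v\<close> in \<open>U\<close>.\<close>

lemma openin_limit_if_openin_vector_topology:
  assumes T: "locally_convex_vector_topology smul T"
    and incl: "\<And>n. continuous_map (norm_topology (A n) (\<nu> n)) T (\<lambda>x. x)"
    and U: "openin T U"
  shows "openin limit_topology U"
  unfolding openin_limit_topology
proof
  fix x assume "x \<in> U"
  have top: "topspace T = UNIV" and add: "continuous_map (prod_topology T T) T (\<lambda>(x, y). x + y)"
    using T by (auto simp: locally_convex_vector_topology_def)
  have sum_nbhds: "\<exists>V W. openin T V \<and> openin T W \<and> a \<in> V \<and> b \<in> W \<and> (\<forall>v\<in>V. \<forall>w\<in>W. v + w \<in> O')"
    if O': "openin T O'" "a + b \<in> O'" for O' a b
  proof -
    have "openin (prod_topology T T) {p \<in> topspace (prod_topology T T). (case p of (x, y) \<Rightarrow> x + y) \<in> O'}"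
      using add O'(1) by (simp only: continuous_map_def)
    then obtain V W where "openin T V" "openin T W" "a \<in> V" "b \<in> W"
      "V \<times> W \<subseteq> {p \<in> topspace (prod_topology T T). (case p of (x, y) \<Rightarrow> x + y) \<in> O'}"
      unfolding openin_prod_topology_alt using O'(2) top by force
    then show ?thesis by (intro exI [of _ V] exI [of _ W]) auto
  qed
  define P where "P n V \<longleftrightarrow> openin T V \<and> 0 \<in> V \<and> (n = 0 \<longrightarrow> (\<forall>v\<in>V. x + v \<in> U))"
    for n :: nat and V
  have "\<exists>V. \<forall>n. P n (V n) \<and> (\<forall>v\<in>V (Suc n). \<forall>w\<in>V (Suc n). v + w \<in> V n)"
  proof (rule dependent_nat_choice)
    show "\<exists>V. P 0 V" using sum_nbhds [OF U, of x 0] \<open>x \<in> U\<close> unfolding P_def by auto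
    fix V n assume "P n V"
    then obtain V1 V2 where "openin T V1" "openin T V2" "0 \<in> V1" "0 \<in> V2"
      "\<forall>v\<in>V1. \<forall>w\<in>V2. v + w \<in> V"
      using sum_nbhds [of V 0 0] unfolding P_def by auto
    then show "\<exists>W. P (Suc n) W \<and> (\<forall>v\<in>W. \<forall>w\<in>W. v + w \<in> V)"
      by (intro exI [of _ "V1 \<inter> V2"]) (auto simp: P_def)
  qed
  then obtain V where V: "\<And>n. P n (V n)" "\<And>n v w. v \<in> V (Suc n) \<Longrightarrow> w \<in> V (Suc n) \<Longrightarrow> v + w \<in> V n"
    by blast
  have "\<exists>e>0. \<forall>y\<in>A i. \<nu> i y < e \<longrightarrow> y \<in> V (Suc i)" for i
  proof -
    have "openin (norm_topology (A i) (\<nu> i)) {y \<in> A i. y \<in> V (Suc i)}"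
      using incl [of i] V(1) [of "Suc i"]
      by (simp add: continuous_map_def P_def unital_Banach_algebra.topspace_norm_topology [OF Banach])
    moreover have "0 \<in> {y \<in> A i. y \<in> V (Suc i)}" using V(1) [of "Suc i"] A_zero by (simp add: P_def)
    ultimately show ?thesis
      unfolding unital_Banach_algebra.openin_norm_topology [OF Banach] by fastforce
  qed
  then obtain \<epsilon> where \<epsilon>: "pos \<epsilon>" "\<And>i y. y \<in> A i \<Longrightarrow> \<nu> i y < \<epsilon> i \<Longrightarrow> y \<in> V (Suc i)" by metis
  \<comment> \<open>The first term and, by induction, the remaining sum both lie in
    \<open>V (Suc k)\<close>; this accounts for the shift of the index by one.\<close>
  have sums: "sum y {k..<k + N} \<in> V k" if "\<And>i. y i \<in> V (Suc i)" for y k N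
  proof (induction N arbitrary: k)
    case (Suc N)
    have "sum y {k..<k + Suc N} = y k + sum y {Suc k..<Suc k + N}"
      by (simp add: sum.atLeast_Suc_lessThan)
    then show ?case using V(2) that Suc [of "Suc k"] by simp
  qed (use V(1) in \<open>simp add: P_def\<close>)
  have "x + v \<in> U" if "v \<in> sum_nbhd \<epsilon>" for v
  proof -
    have "v \<in> V 0" using that sums [where k = 0] \<epsilon>(2) unfolding sum_nbhd_def
      by (auto simp: atLeast0LessThan)
    then show ?thesis using V(1) [of 0] by (simp add: P_def)
  qed
  then show "\<exists>\<epsilon>. pos \<epsilon> \<and> (\<forall>v\<in>sum_nbhd \<epsilon>. x + v \<in> U)" using \<epsilon>(1) by blast
qed

lemma lc_direct_limit_topology_limit_topology:
  "lc_direct_limit_topology smul (\<lambda>n. norm_topology (A n) (\<nu> n)) limit_topology"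
  unfolding lc_direct_limit_topology_def
proof (intro conjI allI impI)
  show "locally_convex_vector_topology smul limit_topology"
    unfolding locally_convex_vector_topology_def
  proof (intro conjI allI impI topspace_limit_topology continuous_map_add continuous_map_scale)
    fix U assume "openin limit_topology U \<and> 0 \<in> U"
    then obtain \<epsilon> where "pos \<epsilon>" "\<forall>v\<in>sum_nbhd \<epsilon>. v \<in> U"
      unfolding openin_limit_topology by fastforce
    then show "\<exists>V. openin limit_topology V \<and> 0 \<in> V \<and> V \<subseteq> U \<and> convex_wrt smul V"
      using openin_translate_sum_nbhd [of 0 \<epsilon>] zero_in_sum_nbhd convex_sum_nbhd
      by (intro exI [of _ "sum_nbhd \<epsilon>"]) auto
  qed
  show "continuous_map (norm_topology (A n) (\<nu> n)) limit_topology (\<lambda>x. x)" for n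
    unfolding continuous_map_def unital_Banach_algebra.topspace_norm_topology [OF Banach]
      unital_Banach_algebra.openin_norm_topology [OF Banach]
  proof (intro conjI allI impI ballI)
    fix U x assume "openin limit_topology U" "x \<in> {x \<in> A n. x \<in> U}"
    then obtain \<epsilon> where x: "x \<in> A n" and \<epsilon>: "pos \<epsilon>" "\<And>v. v \<in> sum_nbhd \<epsilon> \<Longrightarrow> x + v \<in> U"
      unfolding openin_limit_topology by blast
    have "y \<in> U" if "y \<in> A n" "\<nu> n (y - x) < \<epsilon> n" for y
      using \<epsilon>(2) [OF step_in_sum_nbhd [OF \<epsilon>(1) A_diff [OF that(1) x] that(2)]] by simp
    then show "\<exists>r>0. \<forall>y\<in>A n. \<nu> n (y - x) < r \<longrightarrow> y \<in> {x \<in> A n. x \<in> U}"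
      using \<epsilon>(1) by blast
  qed (auto simp: topspace_limit_topology)
qed (use openin_limit_if_openin_vector_topology in blast)

end

section \<open>The unit group\<close>

lemma group_unit_group: "group (unit_group :: 'a::monoid_mult monoid)"
proof -
  have "Group.monoid \<lparr>carrier = (UNIV :: 'a set), mult = (*), one = 1\<rparr>"
    by unfold_locales (auto simp: mult.assoc)
  then show ?thesis unfolding unit_group_def by (rule monoid.units_group)
qed

lemma mult_unit_group [simp]: "x \<otimes>\<^bsub>unit_group\<^esub> y = x * y"
  and one_unit_group [simp]: "\<one>\<^bsub>unit_group\<^esub> = 1"
  by (simp_all add: unit_group_def units_of_def)

lemma inv_unit_group_eq: "x * y = 1 \<Longrightarrow> y * x = 1 \<Longrightarrow> inv\<^bsub>unit_group\<^esub> x = y"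
  by (rule group.inv_equality [OF group_unit_group]) (auto simp: carrier_unit_group)

lemma inv_unit_group:
  assumes "x \<in> carrier unit_group"
  shows "x * inv\<^bsub>unit_group\<^esub> x = 1" "inv\<^bsub>unit_group\<^esub> x * x = 1"
  using group.r_inv [OF group_unit_group assms] group.l_inv [OF group_unit_group assms] by auto

context strict_Banach_algebra_sequence
begin

text \<open>The identity \<open>x + v = x * (1 + y * v)\<close> reduces the claim at
  \<open>x\<close> to inversion near 1. Quantifying over inverses, instead of applying an inverse
  operation, makes the case \<open>U = UNIV\<close> say that the units form an open set.\<close>

lemma openin_inverse_image:
  assumes "openin limit_topology U"
  shows "openin limit_topology {x. \<exists>y. x * y = 1 \<and> y * x = 1 \<and> y \<in> U}"
  unfolding openin_limit_topology
proof
  fix x assume "x \<in> {x. \<exists>y. x * y = 1 \<and> y * x = 1 \<and> y \<in> U}"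
  then obtain y where y: "x * y = 1" "y * x = 1" "y \<in> U" by blast
  then obtain \<epsilon> where \<epsilon>: "pos \<epsilon>" "\<And>v. v \<in> sum_nbhd \<epsilon> \<Longrightarrow> y + v \<in> U"
    using assms unfolding openin_limit_topology by blast
  obtain \<epsilon>1 where \<epsilon>1: "pos \<epsilon>1" "\<And>v. v \<in> sum_nbhd \<epsilon>1 \<Longrightarrow> v * y \<in> sum_nbhd \<epsilon>"
    using sum_nbhd_mult_fixed [OF \<epsilon>(1), where x = y] by metis
  obtain \<delta>1 where \<delta>1: "pos \<delta>1"
    "\<And>v. v \<in> sum_nbhd \<delta>1 \<Longrightarrow> \<exists>w. (1 + v) * w = 1 \<and> w * (1 + v) = 1 \<and> w - 1 \<in> sum_nbhd \<epsilon>1"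
    using sum_nbhd_inverse [OF \<epsilon>1(1)] by blast
  obtain \<delta> where \<delta>: "pos \<delta>" "\<And>v. v \<in> sum_nbhd \<delta> \<Longrightarrow> y * v \<in> sum_nbhd \<delta>1"
    using sum_nbhd_mult_fixed [OF \<delta>1(1), where x = y] by metis
  have "\<exists>z. (x + v) * z = 1 \<and> z * (x + v) = 1 \<and> z \<in> U" if v: "v \<in> sum_nbhd \<delta>" for v
  proof -
    obtain w where w: "(1 + y * v) * w = 1" "w * (1 + y * v) = 1" "w - 1 \<in> sum_nbhd \<epsilon>1"
      using \<delta>1(2) [OF \<delta>(2) [OF v]] by blast
    have eq: "x + v = x * (1 + y * v)" by (simp add: distrib_left mult.assoc [symmetric] y)
    have "(x + v) * (w * y) = x * ((1 + y * v) * w) * y" by (simp only: eq mult.assoc)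
    moreover have "w * y * (x + v) = w * (y * x) * (1 + y * v)" by (simp only: eq mult.assoc)
    moreover have "y + (w - 1) * y = w * y" by (simp add: algebra_simps)
    ultimately show ?thesis
      using w y \<epsilon>(2) [OF \<epsilon>1(2) [OF w(3)]] by (intro exI [of _ "w * y"]) auto
  qed
  then show "\<exists>\<epsilon>. pos \<epsilon> \<and> (\<forall>v\<in>sum_nbhd \<epsilon>. x + v \<in> {x. \<exists>y. x * y = 1 \<and> y * x = 1 \<and> y \<in> U})"
    using \<delta>(1) by blast
qed

lemma topological_group_units:
  "topological_group unit_group (subtopology limit_topology (carrier unit_group))"
  unfolding topological_group_def
proof (intro conjI group_unit_group)
  let ?G = "carrier unit_group :: 'a set"
  let ?T = "subtopology limit_topology ?G"
  show top: "topspace ?T = ?G" by (simp add: topspace_limit_topology)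
  have "continuous_map (prod_topology ?T ?T) limit_topology (\<lambda>(x, y). x * y)"
    unfolding subtopology_Times [symmetric]
    by (rule continuous_map_from_subtopology [OF continuous_map_mult])
  moreover have "(\<lambda>(x, y). x * y) \<in> topspace (prod_topology ?T ?T) \<rightarrow> ?G"
    using group.is_monoid [OF group_unit_group, THEN monoid.m_closed] by (force simp: top)
  ultimately show "continuous_map (prod_topology ?T ?T) ?T (\<lambda>(x, y). x \<otimes>\<^bsub>unit_group\<^esub> y)"
    by (simp add: continuous_map_in_subtopology)
  show "continuous_map ?T ?T (m_inv unit_group)"
    unfolding continuous_map_in_subtopology
  proof (intro conjI)
    show "m_inv unit_group \<in> topspace ?T \<rightarrow> ?G"
      using group.inv_closed [OF group_unit_group] by (auto simp: top)
    show "continuous_map ?T limit_topology (m_inv unit_group)"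
      unfolding continuous_map_def
    proof (intro conjI allI impI)
      fix U :: "'a set" assume "openin limit_topology U"
      moreover have "{x \<in> topspace ?T. inv\<^bsub>unit_group\<^esub> x \<in> U} =
          {x. \<exists>y. x * y = 1 \<and> y * x = 1 \<and> y \<in> U} \<inter> ?G"
        unfolding top by (auto simp: inv_unit_group_eq intro: inv_unit_group)
      ultimately show "openin ?T {x \<in> topspace ?T. inv\<^bsub>unit_group\<^esub> x \<in> U}"
        by (simp only: openin_inverse_image openin_subtopology_Int)
    qed (simp add: topspace_limit_topology)
  qed
qed

section \<open>Products close to 1 and left Cauchy nets\<close>

lemma mult_near_one:
  assumes "pos \<epsilon>"
  obtains \<delta> where "pos \<delta>"
    "\<And>p q. p - 1 \<in> sum_nbhd \<delta> \<Longrightarrow> q - 1 \<in> sum_nbhd \<delta> \<Longrightarrow> p * q - 1 \<in> sum_nbhd \<epsilon>"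
proof -
  have h: "pos (\<lambda>i. \<epsilon> i / 2)" using assms by simp
  obtain \<gamma> where \<gamma>: "pos \<gamma>"
    "\<And>u v. u \<in> sum_nbhd \<gamma> \<Longrightarrow> v \<in> sum_nbhd \<gamma> \<Longrightarrow> u * v \<in> sum_nbhd (\<lambda>i. \<epsilon> i / 2)"
    using sum_nbhd_mult [OF h] by blast
  define \<delta> where "\<delta> i = min (\<gamma> i) (\<epsilon> i / 2 / 2)" for i
  have sub: "sum_nbhd \<delta> \<subseteq> sum_nbhd \<gamma>" "sum_nbhd \<delta> \<subseteq> sum_nbhd (\<lambda>i. \<epsilon> i / 2 / 2)"
    by (rule sum_nbhd_mono; simp add: \<delta>_def)+
  have "p * q - 1 \<in> sum_nbhd \<epsilon>" if "p - 1 \<in> sum_nbhd \<delta>" "q - 1 \<in> sum_nbhd \<delta>" for p q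
  proof -
    have "(p - 1) * (q - 1) + ((p - 1) + (q - 1)) \<in> sum_nbhd \<epsilon>"
      using that sub \<gamma>(2) by (intro sum_nbhd_add_half) blast+
    moreover have "(p - 1) * (q - 1) + ((p - 1) + (q - 1)) = p * q - 1" by (simp add: algebra_simps)
    ultimately show ?thesis by simp
  qed
  moreover have "pos \<delta>" using \<gamma>(1) assms by (simp add: \<delta>_def)
  ultimately show thesis using that by blast
qed

text \<open>Made for comparing two units \<open>a\<close> and \<open>b\<close> of a step that
  approximate the net, with inverses \<open>a'\<close> and \<open>b'\<close>: \<open>a' * b\<close>
  is the product of \<open>a' * x \<alpha>\<close>, \<open>y \<alpha> * x \<beta>\<close> and
  \<open>y \<beta> * b\<close>, the last being inverse to \<open>b' * x \<beta>\<close>.\<close>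

lemma mult_mult_inverse_near_one:
  assumes "pos \<epsilon>"
  obtains \<delta> where "pos \<delta>"
    "\<And>p q r r'. \<lbrakk>p - 1 \<in> sum_nbhd \<delta>; q - 1 \<in> sum_nbhd \<delta>; r - 1 \<in> sum_nbhd \<delta>; r * r' = 1\<rbrakk>
       \<Longrightarrow> p * q * r' - 1 \<in> sum_nbhd \<epsilon>"
proof -
  obtain \<delta>1 where \<delta>1: "pos \<delta>1"
    "\<And>p q. p - 1 \<in> sum_nbhd \<delta>1 \<Longrightarrow> q - 1 \<in> sum_nbhd \<delta>1 \<Longrightarrow> p * q - 1 \<in> sum_nbhd \<epsilon>"
    using mult_near_one [OF assms] by blast
  obtain \<delta>2 where \<delta>2: "pos \<delta>2"
    "\<And>p q. p - 1 \<in> sum_nbhd \<delta>2 \<Longrightarrow> q - 1 \<in> sum_nbhd \<delta>2 \<Longrightarrow> p * q - 1 \<in> sum_nbhd \<delta>1"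
    using mult_near_one [OF \<delta>1(1)] by blast
  obtain \<delta>3 where \<delta>3: "pos \<delta>3"
    "\<And>v. v \<in> sum_nbhd \<delta>3 \<Longrightarrow> \<exists>w. (1 + v) * w = 1 \<and> w * (1 + v) = 1 \<and> w - 1 \<in> sum_nbhd \<delta>1"
    using sum_nbhd_inverse [OF \<delta>1(1)] by blast
  define \<delta> where "\<delta> i = min (\<delta>2 i) (\<delta>3 i)" for i
  have sub: "sum_nbhd \<delta> \<subseteq> sum_nbhd \<delta>2" "sum_nbhd \<delta> \<subseteq> sum_nbhd \<delta>3"
    by (rule sum_nbhd_mono; simp add: \<delta>_def)+
  have "r' - 1 \<in> sum_nbhd \<delta>1" if r: "r - 1 \<in> sum_nbhd \<delta>" "r * r' = 1" for r r'
  proof -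
    obtain w where w: "w * r = 1" "w - 1 \<in> sum_nbhd \<delta>1" using \<delta>3(2) [of "r - 1"] r(1) sub by auto
    then have "w = r'" using r(2) by (metis mult.assoc mult_1_left mult_1_right)
    then show ?thesis using w by simp
  qed
  then have "p * q * r' - 1 \<in> sum_nbhd \<epsilon>"
    if "p - 1 \<in> sum_nbhd \<delta>" "q - 1 \<in> sum_nbhd \<delta>" "r - 1 \<in> sum_nbhd \<delta>" "r * r' = 1" for p q r r'
    using that \<delta>1(2) \<delta>2(2) sub by blast
  moreover have "pos \<delta>" using \<delta>2 \<delta>3 by (simp add: \<delta>_def)
  ultimately show thesis using that by blast
qed

text \<open>If the net stayed away from the units of every step \<open>A n\<close>, with distance measured by
  \<open>\<epsilon> n\<close>, then a neighbourhood of 1 adapted to all \<open>\<epsilon> n\<close> simultaneously, as provided by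
  \<open>sum_nbhd_factorization\<close>, would contradict the Cauchy property.\<close>

lemma left_Cauchy_net_close_to_step:
  assumes dir: "directed_preorder I leq"
    and xy: "\<And>\<alpha>. \<alpha> \<in> I \<Longrightarrow> x \<alpha> * y \<alpha> = 1" "\<And>\<alpha>. \<alpha> \<in> I \<Longrightarrow> y \<alpha> * x \<alpha> = 1"
    and Cauchy: "\<And>\<epsilon>. pos \<epsilon> \<Longrightarrow> \<exists>\<gamma>\<in>I. \<forall>\<alpha>\<in>I. \<forall>\<beta>\<in>I. leq \<gamma> \<alpha> \<and> leq \<gamma> \<beta> \<longrightarrow> y \<beta> * x \<alpha> - 1 \<in> sum_nbhd \<epsilon>"
  shows "\<exists>n. \<forall>\<epsilon> \<gamma>. pos \<epsilon> \<longrightarrow> \<gamma> \<in> I \<longrightarrow>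
    (\<exists>\<alpha>\<in>I. leq \<gamma> \<alpha> \<and> (\<exists>a a'. a \<in> A n \<and> a' \<in> A n \<and> a * a' = 1 \<and> a' * a = 1 \<and> a' * x \<alpha> - 1 \<in> sum_nbhd \<epsilon>))"
proof (rule ccontr)
  assume "\<not> ?thesis"
  then have "\<exists>\<epsilon> \<gamma>. pos \<epsilon> \<and> \<gamma> \<in> I \<and> (\<forall>\<alpha>\<in>I. leq \<gamma> \<alpha> \<longrightarrow>
      (\<forall>a a'. a \<in> A n \<and> a' \<in> A n \<and> a * a' = 1 \<and> a' * a = 1 \<longrightarrow> a' * x \<alpha> - 1 \<notin> sum_nbhd \<epsilon>))" for n
    by blast
  then obtain \<epsilon> \<gamma> where \<epsilon>: "\<And>n. pos (\<epsilon> n)" and \<gamma>: "\<And>n. \<gamma> n \<in> I" and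
    far: "\<And>n \<alpha> a a'. \<lbrakk>\<alpha> \<in> I; leq (\<gamma> n) \<alpha>; a \<in> A n; a' \<in> A n; a * a' = 1; a' * a = 1\<rbrakk>
      \<Longrightarrow> a' * x \<alpha> - 1 \<notin> sum_nbhd (\<epsilon> n)"
    by metis
  obtain \<delta> where \<delta>: "pos \<delta>" and
    fact: "\<And>v n. v \<in> sum_nbhd \<delta> \<Longrightarrow> \<exists>a a' u. a \<in> A n \<and> a' \<in> A n \<and> a * a' = 1 \<and> a' * a = 1 \<and>
      u \<in> sum_nbhd (\<epsilon> n) \<and> 1 + v = a * (1 + u)"
    using sum_nbhd_factorization [of \<epsilon>] \<epsilon> by metis
  obtain \<beta> where \<beta>: "\<beta> \<in> I" "\<And>\<alpha>. \<alpha> \<in> I \<Longrightarrow> leq \<beta> \<alpha> \<Longrightarrow> y \<beta> * x \<alpha> - 1 \<in> sum_nbhd \<delta>"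
    using Cauchy [OF \<delta>] dir unfolding directed_preorder_def by meson
  obtain m k where "x \<beta> \<in> A m" "y \<beta> \<in> A k" by (meson in_some_A)
  then obtain n where n: "x \<beta> \<in> A n" "y \<beta> \<in> A n"
    by (metis A_mono max.cobounded1 max.cobounded2)
  obtain \<alpha> where \<alpha>: "\<alpha> \<in> I" "leq \<beta> \<alpha>" "leq (\<gamma> n) \<alpha>"
    using dir \<beta>(1) \<gamma> unfolding directed_preorder_def by meson
  obtain a a' u where a: "a \<in> A n" "a' \<in> A n" "a * a' = 1" "a' * a = 1" "u \<in> sum_nbhd (\<epsilon> n)"
    "y \<beta> * x \<alpha> = a * (1 + u)"
    using fact [OF \<beta>(2) [OF \<alpha>(1,2)], of n] by auto
  \<comment> \<open>The unit of \<open>A n\<close> that \<open>far\<close> excludes is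
    \<open>x \<beta> * a\<close>: its inverse \<open>a' * y \<beta>\<close> takes
    \<open>x \<alpha>\<close> to \<open>1 + u\<close>.\<close>
  have "x \<beta> * a * (a' * y \<beta>) = x \<beta> * (a * a') * y \<beta>"
    "a' * y \<beta> * (x \<beta> * a) = a' * (y \<beta> * x \<beta>) * a"
    by (simp_all only: mult.assoc)
  then have "x \<beta> * a * (a' * y \<beta>) = 1" "a' * y \<beta> * (x \<beta> * a) = 1"
    using a xy \<beta>(1) by simp_all
  then have "a' * y \<beta> * x \<alpha> - 1 \<notin> sum_nbhd (\<epsilon> n)"
    using far [OF \<alpha>(1,3)] n a A_mult by blast
  moreover have "a' * y \<beta> * x \<alpha> = 1 + u"
    using a by (metis mult.assoc mult_1_left)
  ultimately show False using a(5) by simp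
qed

text \<open>For a unit \<open>b\<close> of the step close to some \<open>x \<beta>\<close>, with
  inverse \<open>b'\<close>, the element \<open>l' * x \<alpha>\<close> is the product of
  \<open>l' * b\<close>, \<open>b' * x \<beta>\<close> and \<open>y \<beta> * x \<alpha>\<close>.
  These are close to 1 by convergence in norm, by approximation and by the Cauchy property.\<close>

lemma left_Cauchy_net_limit:
  assumes dir: "directed_preorder I leq"
    and xy: "\<And>\<alpha>. \<alpha> \<in> I \<Longrightarrow> x \<alpha> * y \<alpha> = 1" "\<And>\<alpha>. \<alpha> \<in> I \<Longrightarrow> y \<alpha> * x \<alpha> = 1"
    and Cauchy: "\<And>\<epsilon>. pos \<epsilon> \<Longrightarrow> \<exists>\<gamma>\<in>I. \<forall>\<alpha>\<in>I. \<forall>\<beta>\<in>I. leq \<gamma> \<alpha> \<and> leq \<gamma> \<beta> \<longrightarrow> y \<beta> * x \<alpha> - 1 \<in> sum_nbhd \<epsilon>"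
  obtains l l' where "l * l' = 1" "l' * l = 1"
    "\<And>\<epsilon>. pos \<epsilon> \<Longrightarrow> \<exists>\<gamma>\<in>I. \<forall>\<alpha>\<in>I. leq \<gamma> \<alpha> \<longrightarrow> l' * x \<alpha> - 1 \<in> sum_nbhd \<epsilon>"
proof -
  have dir_trans: "leq \<alpha> \<gamma>" if "leq \<alpha> \<beta>" "leq \<beta> \<gamma>" "\<alpha> \<in> I" "\<beta> \<in> I" "\<gamma> \<in> I" for \<alpha> \<beta> \<gamma>
    using dir that unfolding directed_preorder_def by blast
  have dir_refl: "leq \<alpha> \<alpha>" if "\<alpha> \<in> I" for \<alpha> using dir that by (simp add: directed_preorder_def)
  have dir_ub: "\<exists>\<gamma>\<in>I. leq \<alpha> \<gamma> \<and> leq \<beta> \<gamma>" if "\<alpha> \<in> I" "\<beta> \<in> I" for \<alpha> \<beta>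
    using dir that unfolding directed_preorder_def by blast
  obtain n where close: "\<And>\<epsilon> \<gamma>. pos \<epsilon> \<Longrightarrow> \<gamma> \<in> I \<Longrightarrow>
      \<exists>\<alpha>\<in>I. leq \<gamma> \<alpha> \<and> (\<exists>a a'. a \<in> A n \<and> a' \<in> A n \<and> a * a' = 1 \<and> a' * a = 1 \<and> a' * x \<alpha> - 1 \<in> sum_nbhd \<epsilon>)"
    using left_Cauchy_net_close_to_step [OF dir xy Cauchy] by metis
  \<comment> \<open>\<open>Q k \<delta>\<close> passes from the limit topology to the norm: products
    formed at scale \<open>\<delta>\<close> are within \<open>1 / real (Suc k)\<close> of 1 as soon
    as they differ from 1 by an element of \<open>A n\<close>.\<close>
  define Q where "Q k \<delta> \<longleftrightarrow> (\<forall>p q r r'. p - 1 \<in> sum_nbhd \<delta> \<and> q - 1 \<in> sum_nbhd \<delta> \<and>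
      r - 1 \<in> sum_nbhd \<delta> \<and> r * r' = 1 \<and> p * q * r' - 1 \<in> A n \<longrightarrow>
      \<nu> n (p * q * r' - 1) < 1 / real (Suc k))" for k \<delta>
  have "\<exists>\<delta>. pos \<delta> \<and> Q k \<delta>" for k
  proof -
    have "0 < 1 / real (Suc k)" by simp
    from sum_nbhd_Int_step [OF this, of n]
    obtain \<epsilon> where \<epsilon>: "pos \<epsilon>" "\<And>v. v \<in> sum_nbhd \<epsilon> \<Longrightarrow> v \<in> A n \<Longrightarrow> \<nu> n v < 1 / real (Suc k)"
      by metis
    obtain \<delta> where \<delta>: "pos \<delta>"
      "\<And>p q r r'. \<lbrakk>p - 1 \<in> sum_nbhd \<delta>; q - 1 \<in> sum_nbhd \<delta>; r - 1 \<in> sum_nbhd \<delta>; r * r' = 1\<rbrakk>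
        \<Longrightarrow> p * q * r' - 1 \<in> sum_nbhd \<epsilon>"
      using mult_mult_inverse_near_one [OF \<epsilon>(1)] by metis
    then show ?thesis using \<epsilon>(2) unfolding Q_def by blast
  qed
  then obtain \<delta> where \<delta>: "\<And>k. pos (\<delta> k)" and Q: "\<And>k. Q k (\<delta> k)" by metis
  have small: "\<nu> n (p * q * r' - 1) < 1 / real (Suc k)"
    if "p - 1 \<in> sum_nbhd (\<delta> k)" "q - 1 \<in> sum_nbhd (\<delta> k)" "r - 1 \<in> sum_nbhd (\<delta> k)"
      "r * r' = 1" "p * q * r' - 1 \<in> A n" for k p q r r'
    using Q [of k] that unfolding Q_def by blast
  \<comment> \<open>The minima make the scales decrease in \<open>k\<close>, so an approximation at
    scale \<open>d m\<close> is also one at every scale \<open>d k\<close> with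
    \<open>k \<le> m\<close>.\<close>
  define d where "d k i = Min ((\<lambda>j. \<delta> j i) ` {..k})" for k i
  have d_pos: "pos (d k)" for k using \<delta> by (auto simp: d_def)
  have d_sub: "sum_nbhd (d m) \<subseteq> sum_nbhd (\<delta> k)" if "k \<le> m" for k m
    by (rule sum_nbhd_mono) (use that in \<open>auto simp: d_def\<close>)
  define P where "P k \<gamma> \<longleftrightarrow> \<gamma> \<in> I \<and>
    (\<forall>\<alpha>\<in>I. \<forall>\<beta>\<in>I. leq \<gamma> \<alpha> \<and> leq \<gamma> \<beta> \<longrightarrow> y \<beta> * x \<alpha> - 1 \<in> sum_nbhd (d k))" for k \<gamma>
  have "\<exists>\<gamma>. \<forall>k. P k (\<gamma> k) \<and> leq (\<gamma> k) (\<gamma> (Suc k))"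
  proof (rule dependent_nat_choice)
    show "\<exists>\<gamma>. P 0 \<gamma>" using Cauchy [OF d_pos [of 0]] by (auto simp: P_def)
    fix \<gamma> k assume "P k \<gamma>"
    then have \<gamma>: "\<gamma> \<in> I" by (simp add: P_def)
    obtain \<gamma>' where \<gamma>': "P (Suc k) \<gamma>'" using Cauchy [OF d_pos [of "Suc k"]] unfolding P_def by blast
    then have "\<gamma>' \<in> I" by (simp add: P_def)
    then obtain \<gamma>'' where \<gamma>'': "\<gamma>'' \<in> I" "leq \<gamma> \<gamma>''" "leq \<gamma>' \<gamma>''" using dir_ub [OF \<gamma>] by blast
    have "leq \<gamma>' \<alpha>" if "\<alpha> \<in> I" "leq \<gamma>'' \<alpha>" for \<alpha>
      by (rule dir_trans [OF \<gamma>''(3) that(2) \<open>\<gamma>' \<in> I\<close> \<gamma>''(1) that(1)])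
    then have "P (Suc k) \<gamma>''" using \<gamma>' \<gamma>''(1) unfolding P_def by blast
    then show "\<exists>\<gamma>'. P (Suc k) \<gamma>' \<and> leq \<gamma> \<gamma>'" using \<gamma>''(2) by blast
  qed
  then obtain \<gamma> where P: "\<And>k. P k (\<gamma> k)" and \<gamma>_Suc: "\<And>k. leq (\<gamma> k) (\<gamma> (Suc k))" by blast
  have \<gamma>: "\<gamma> k \<in> I" for k using P by (simp add: P_def)
  have \<gamma>_mono: "leq (\<gamma> k) (\<gamma> m)" if "k \<le> m" for k m
    using that by (induction m rule: dec_induct) (use \<gamma> \<gamma>_Suc dir_refl dir_trans in blast)+
  have "\<exists>\<alpha> a a'. \<alpha> \<in> I \<and> leq (\<gamma> k) \<alpha> \<and> a \<in> A n \<and> a' \<in> A n \<and> a * a' = 1 \<and> a' * a = 1 \<and>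
      a' * x \<alpha> - 1 \<in> sum_nbhd (d k)" for k
    using close [OF d_pos \<gamma>] by blast
  then obtain \<alpha> a a' where \<alpha>: "\<And>k. \<alpha> k \<in> I" "\<And>k. leq (\<gamma> k) (\<alpha> k)" and
    a: "\<And>k. a k \<in> A n" "\<And>k. a' k \<in> A n" "\<And>k. a k * a' k = 1" "\<And>k. a' k * a k = 1" and
    ax: "\<And>k. a' k * x (\<alpha> k) - 1 \<in> sum_nbhd (d k)"
    by metis
  \<comment> \<open>Used twice: with \<open>b = a m\<close> for the Cauchy property of the sequence,
    and below to compare \<open>a k\<close> with a unit adapted to a given
    \<open>\<epsilon>\<close>.\<close>
  have near: "\<nu> n (a' k * b - 1) < 1 / real (Suc k)"
    if "\<beta> \<in> I" "leq (\<gamma> k) \<beta>" "b \<in> A n" "b' * b = 1" "b' * x \<beta> - 1 \<in> sum_nbhd (d k)" for k \<beta> b b'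
  proof -
    have "a' k * x (\<alpha> k) * (y (\<alpha> k) * x \<beta>) * (y \<beta> * b) =
        a' k * (x (\<alpha> k) * y (\<alpha> k)) * (x \<beta> * y \<beta>) * b" by (simp only: mult.assoc)
    then have prod: "a' k * x (\<alpha> k) * (y (\<alpha> k) * x \<beta>) * (y \<beta> * b) = a' k * b"
      using xy \<alpha> that(1) by simp
    have "b' * x \<beta> * (y \<beta> * b) = b' * (x \<beta> * y \<beta>) * b" by (simp only: mult.assoc)
    then have inv: "b' * x \<beta> * (y \<beta> * b) = 1" using xy that by simp
    have "y (\<alpha> k) * x \<beta> - 1 \<in> sum_nbhd (d k)"
      using P [of k] \<alpha> that unfolding P_def by blast
    moreover have "a' k * b - 1 \<in> A n" using a that A_mult A_one A_diff by simp
    ultimately show ?thesis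
      using small [OF _ _ _ inv, of "a' k * x (\<alpha> k)" k "y (\<alpha> k) * x \<beta>"]
        ax that(5) d_sub [OF order_refl, of k] unfolding prod by blast
  qed
  have "\<nu> n (a' k * a m - 1) < 1 / real (Suc k)" if "k \<le> m" for k m
  proof (rule near [OF \<alpha>(1) _ a(1) a(4)])
    \<comment> \<open>The indices \<open>\<alpha> m\<close> need not increase, but all those with
      \<open>m \<ge> k\<close> lie above \<open>\<gamma> k\<close>.\<close>
    show "leq (\<gamma> k) (\<alpha> m)" using \<gamma>_mono [OF that] \<alpha> \<gamma> dir_trans by blast
    have "sum_nbhd (d m) \<subseteq> sum_nbhd (d k)"
      by (rule sum_nbhd_mono) (use that in \<open>auto simp: d_def intro!: Min_antimono\<close>)
    then show "a' m * x (\<alpha> m) - 1 \<in> sum_nbhd (d k)" using ax by blast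
  qed
  then obtain l l' where l: "l \<in> A n" "l' \<in> A n" "l * l' = 1" "l' * l = 1"
    and la: "\<And>k. k \<ge> 1 \<Longrightarrow> \<nu> n (l' * a k - 1) \<le> 2 / real (Suc k)"
    using unital_Banach_algebra.left_Cauchy_units_converge [OF Banach, of a n a'] a by blast
  have "\<exists>\<gamma>\<in>I. \<forall>\<alpha>\<in>I. leq \<gamma> \<alpha> \<longrightarrow> l' * x \<alpha> - 1 \<in> sum_nbhd \<epsilon>" if \<epsilon>: "pos \<epsilon>" for \<epsilon>
  proof -
    obtain \<delta>1 where \<delta>1: "pos \<delta>1"
      "\<And>p q. p - 1 \<in> sum_nbhd \<delta>1 \<Longrightarrow> q - 1 \<in> sum_nbhd \<delta>1 \<Longrightarrow> p * q - 1 \<in> sum_nbhd \<epsilon>"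
      using mult_near_one [OF \<epsilon>] by blast
    obtain \<delta>2 where \<delta>2: "pos \<delta>2"
      "\<And>p q. p - 1 \<in> sum_nbhd \<delta>2 \<Longrightarrow> q - 1 \<in> sum_nbhd \<delta>2 \<Longrightarrow> p * q - 1 \<in> sum_nbhd \<delta>1"
      using mult_near_one [OF \<delta>1(1)] by blast
    \<comment> \<open>The 5 is 2 + 2 + 1, from the bounds for \<open>s * t\<close>, \<open>s\<close>
      and \<open>t\<close> below in units of \<open>1 / real (Suc k)\<close>. Taking
      \<open>k = Suc k0\<close> secures \<open>k \<ge> 1\<close>, as \<open>la\<close>
      requires.\<close>
    obtain k0 where k0: "5 / \<delta>1 n < real k0" using reals_Archimedean2 by blast
    define k where "k = Suc k0"
    have k: "k \<ge> 1" "5 / real (Suc k) < \<delta>1 n"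
    proof -
      have "5 < real k0 * \<delta>1 n" using k0 \<delta>1(1) by (simp add: pos_divide_less_eq)
      also have "\<dots> \<le> real (Suc k) * \<delta>1 n" using \<delta>1(1) by (simp add: k_def mult_right_mono less_imp_le)
      finally show "5 / real (Suc k) < \<delta>1 n" by (simp add: pos_divide_less_eq mult.commute)
    qed (simp add: k_def)
    obtain \<gamma>1 where \<gamma>1: "\<gamma>1 \<in> I"
      "\<And>\<alpha> \<beta>. \<alpha> \<in> I \<Longrightarrow> \<beta> \<in> I \<Longrightarrow> leq \<gamma>1 \<alpha> \<Longrightarrow> leq \<gamma>1 \<beta> \<Longrightarrow> y \<beta> * x \<alpha> - 1 \<in> sum_nbhd \<delta>2"
      using Cauchy [OF \<delta>2(1)] by blast
    obtain \<gamma>2 where \<gamma>2: "\<gamma>2 \<in> I" "leq \<gamma>1 \<gamma>2" "leq (\<gamma> k) \<gamma>2" using dir_ub \<gamma>1(1) \<gamma> by blast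
    define \<eta> where "\<eta> i = min (\<delta>2 i) (d k i)" for i
    have \<eta>: "pos \<eta>" "sum_nbhd \<eta> \<subseteq> sum_nbhd \<delta>2" "sum_nbhd \<eta> \<subseteq> sum_nbhd (d k)"
      using \<delta>2(1) d_pos by (simp add: \<eta>_def) (rule sum_nbhd_mono; simp add: \<eta>_def)+
    obtain \<beta> b b' where \<beta>: "\<beta> \<in> I" "leq \<gamma>2 \<beta>" and b: "b \<in> A n" "b' \<in> A n" "b * b' = 1" "b' * b = 1"
      and bx: "b' * x \<beta> - 1 \<in> sum_nbhd \<eta>"
      using close [OF \<eta>(1) \<gamma>2(1)] by blast
    have \<beta>_ge: "leq \<gamma>1 \<beta>" "leq (\<gamma> k) \<beta>" using \<beta> \<gamma>2 \<gamma>1(1) \<gamma> dir_trans by blast+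
    have lb: "l' * b - 1 \<in> sum_nbhd \<delta>1"
    proof (rule step_in_sum_nbhd [OF \<delta>1(1)])
      show "l' * b - 1 \<in> A n" using l b A_mult A_one A_diff by blast
      define s where "s = l' * a k - 1"
      define t where "t = a' k * b - 1"
      have st: "s \<in> A n" "t \<in> A n"
        unfolding s_def t_def using l a b A_mult A_one A_diff by blast+
      have s: "\<nu> n s \<le> 2 / real (Suc k)" using la [OF k(1)] by (simp add: s_def)
      have t: "\<nu> n t \<le> 1 / real (Suc k)"
        using near [OF \<beta>(1) \<beta>_ge(2) b(1) b(4)] bx \<eta>(3) by (force simp: t_def)
      have "(s + 1) * (t + 1) = l' * (a k * a' k) * b" by (simp add: s_def t_def mult.assoc)
      then have "l' * b = (s + 1) * (t + 1)" by (simp add: a)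
      then have "l' * b - 1 = s * t + (s + t)" by (simp add: algebra_simps)
      also have "\<nu> n (s * t + (s + t)) \<le> \<nu> n (s * t) + (\<nu> n s + \<nu> n t)"
        using \<nu>_triangle [of "s * t" n "s + t"] \<nu>_triangle [OF st] st A_mult A_add by fastforce
      also have "\<nu> n (s * t) \<le> 2 / real (Suc k) * 1"
      proof -
        have "\<nu> n t \<le> 1" using t by (rule order_trans) simp
        then have "\<nu> n s * \<nu> n t \<le> 2 / real (Suc k) * 1"
          using s \<nu>_nonneg [OF st(2)] by (intro mult_mono) auto
        then show ?thesis using \<nu>_mult [OF st] by linarith
      qed
      also have "2 / real (Suc k) * 1 + (\<nu> n s + \<nu> n t) \<le> 5 / real (Suc k)"
        using s t by (simp add: add_divide_distrib [symmetric])
      finally show "\<nu> n (l' * b - 1) < \<delta>1 n" using k(2) by simp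
    qed
    have "l' * x \<alpha> - 1 \<in> sum_nbhd \<epsilon>" if \<alpha>: "\<alpha> \<in> I" "leq \<gamma>1 \<alpha>" for \<alpha>
    proof -
      have "b' * x \<beta> * (y \<beta> * x \<alpha>) - 1 \<in> sum_nbhd \<delta>1"
        by (rule \<delta>2(2) [OF subsetD [OF \<eta>(2) bx] \<gamma>1(2) [OF \<alpha>(1) \<beta>(1) \<alpha>(2) \<beta>_ge(1)]])
      then have "l' * b * (b' * x \<beta> * (y \<beta> * x \<alpha>)) - 1 \<in> sum_nbhd \<epsilon>" by (rule \<delta>1(2) [OF lb])
      moreover have "l' * b * (b' * x \<beta> * (y \<beta> * x \<alpha>)) = l' * (b * b') * (x \<beta> * y \<beta>) * x \<alpha>"
        by (simp only: mult.assoc)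
      ultimately show ?thesis using b(3) xy(1) [OF \<beta>(1)] by simp
    qed
    then show ?thesis using \<gamma>1(1) by blast
  qed
  then show thesis by (rule that [OF l(3,4)])
qed

lemma complete_topological_group_units:
  "complete_topological_group TYPE('i) unit_group (subtopology limit_topology (carrier unit_group))"
  unfolding complete_topological_group_def
proof (intro conjI topological_group_units allI impI)
  fix I :: "'i set" and leq x
  let ?G = "carrier unit_group :: 'a set"
  assume "directed_preorder I leq \<and> left_Cauchy_net unit_group (subtopology limit_topology ?G) I leq x"
  then have dir: "directed_preorder I leq" and mem: "\<And>\<alpha>. \<alpha> \<in> I \<Longrightarrow> x \<alpha> \<in> ?G"
    and nets: "\<And>U. openin (subtopology limit_topology ?G) U \<Longrightarrow> 1 \<in> U \<Longrightarrow>
      \<exists>\<gamma>\<in>I. \<forall>\<alpha>\<in>I. \<forall>\<beta>\<in>I. leq \<gamma> \<alpha> \<and> leq \<gamma> \<beta> \<longrightarrow> inv\<^bsub>unit_group\<^esub> x \<beta> * x \<alpha> \<in> U"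
    by (auto simp: left_Cauchy_net_def)
  define y where "y \<alpha> = inv\<^bsub>unit_group\<^esub> x \<alpha>" for \<alpha>
  have xy: "x \<alpha> * y \<alpha> = 1" "y \<alpha> * x \<alpha> = 1" if "\<alpha> \<in> I" for \<alpha>
    by (simp_all add: y_def inv_unit_group mem that)
  have Cauchy: "\<exists>\<gamma>\<in>I. \<forall>\<alpha>\<in>I. \<forall>\<beta>\<in>I. leq \<gamma> \<alpha> \<and> leq \<gamma> \<beta> \<longrightarrow> y \<beta> * x \<alpha> - 1 \<in> sum_nbhd \<epsilon>"
    if "pos \<epsilon>" for \<epsilon>
  proof -
    have "openin (subtopology limit_topology ?G) ({z. z - 1 \<in> sum_nbhd \<epsilon>} \<inter> ?G)"
      using openin_translate_sum_nbhd openin_subtopology by blast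
    moreover have "1 \<in> {z. z - 1 \<in> sum_nbhd \<epsilon>} \<inter> ?G"
      using zero_in_sum_nbhd [OF that] by (auto simp: carrier_unit_group)
    ultimately obtain \<gamma> where "\<gamma> \<in> I" "\<forall>\<alpha>\<in>I. \<forall>\<beta>\<in>I. leq \<gamma> \<alpha> \<and> leq \<gamma> \<beta> \<longrightarrow>
        inv\<^bsub>unit_group\<^esub> x \<beta> * x \<alpha> \<in> {z. z - 1 \<in> sum_nbhd \<epsilon>} \<inter> ?G"
      using nets by meson
    then show ?thesis unfolding y_def by (intro bexI [of _ \<gamma>]) simp_all
  qed
  obtain l l' where l: "l * l' = 1" "l' * l = 1"
    and lim: "\<And>\<epsilon>. pos \<epsilon> \<Longrightarrow> \<exists>\<gamma>\<in>I. \<forall>\<alpha>\<in>I. leq \<gamma> \<alpha> \<longrightarrow> l' * x \<alpha> - 1 \<in> sum_nbhd \<epsilon>"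
    using left_Cauchy_net_limit [OF dir xy Cauchy] by metis
  have "\<exists>\<gamma>\<in>I. \<forall>\<alpha>\<in>I. leq \<gamma> \<alpha> \<longrightarrow> x \<alpha> \<in> U"
    if U: "openin (subtopology limit_topology ?G) U" "l \<in> U" for U
  proof -
    obtain V where V: "openin limit_topology V" "U = V \<inter> ?G" using U(1) by (auto simp: openin_subtopology)
    then obtain \<epsilon> where \<epsilon>: "pos \<epsilon>" "\<And>v. v \<in> sum_nbhd \<epsilon> \<Longrightarrow> l + v \<in> V"
      using U(2) unfolding openin_limit_topology by blast
    obtain \<delta> where \<delta>: "pos \<delta>" "\<And>v. v \<in> sum_nbhd \<delta> \<Longrightarrow> l * v \<in> sum_nbhd \<epsilon>"
      using sum_nbhd_mult_fixed [OF \<epsilon>(1), where x = l] by metis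
    obtain \<gamma> where \<gamma>: "\<gamma> \<in> I" "\<And>\<alpha>. \<alpha> \<in> I \<Longrightarrow> leq \<gamma> \<alpha> \<Longrightarrow> l' * x \<alpha> - 1 \<in> sum_nbhd \<delta>"
      using lim [OF \<delta>(1)] by blast
    have "l + l * (l' * x \<alpha> - 1) = x \<alpha>" for \<alpha>
      by (simp add: right_diff_distrib mult.assoc [symmetric] l)
    then have "x \<alpha> \<in> U" if "\<alpha> \<in> I" "leq \<gamma> \<alpha>" for \<alpha>
      using \<epsilon>(2) [OF \<delta>(2) [OF \<gamma>(2) [OF that]]] V(2) mem [OF that(1)] by simp
    then show ?thesis using \<gamma>(1) by blast
  qed
  moreover have "l \<in> ?G" using l by (auto simp: carrier_unit_group)
  ultimately show "\<exists>l. net_converges_to (subtopology limit_topology ?G) I leq x l"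
    unfolding net_converges_to_def by (auto simp: topspace_limit_topology)
qed

end

section \<open>Comparison of the norms\<close>

text \<open>\<open>x\<close> is rescaled so that \<open>p\<close> takes the value
  \<open>r / 2\<close>, strictly inside the ball, whence the factor 2. If \<open>p x = 0\<close> no
  scalar achieves this, and the assumption on the zeros of \<open>p\<close> takes over.\<close>

lemma norm_le_if_bounded_on_ball:
  fixes smul :: "'k::real_normed_field \<Rightarrow> 'a::ab_group_add \<Rightarrow> 'a"
  assumes r: "r > 0" "\<And>x. x \<in> S \<Longrightarrow> p x < r \<Longrightarrow> q x < 1"
    and S: "\<And>c x. x \<in> S \<Longrightarrow> smul c x \<in> S"
    and p: "\<And>x. x \<in> S \<Longrightarrow> 0 \<le> p x" "\<And>x. x \<in> S \<Longrightarrow> p x = 0 \<Longrightarrow> q x = 0"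
    and scale: "\<And>c x. x \<in> S \<Longrightarrow> p (smul c x) = norm c * p x"
      "\<And>c x. x \<in> S \<Longrightarrow> q (smul c x) = norm c * q x"
    and x: "x \<in> S"
  shows "q x \<le> 2 / r * p x"
proof (cases "p x = 0")
  case True
  then show ?thesis using p(2) [OF x] by simp
next
  case False
  then have pos: "p x > 0" using p(1) [OF x] by simp
  define c where "c = r / (2 * p x)"
  have c: "c > 0" using r(1) pos by (simp add: c_def)
  have "c * p x = r / 2" using pos by (simp add: c_def)
  then have "p (smul (of_real c) x) < r" using c r(1) by (simp add: scale x)
  then have "q (smul (of_real c) x) < 1" using r S [OF x] by simp
  then have "c * q x < 1" using c by (simp add: scale x)
  then show ?thesis using pos r(1) by (simp add: c_def field_simps)
qed

text \<open>On \<open>S\<close>, the unit ball of either norm is a neighbourhood of 0 for the other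
  one: continuity of the inclusion yields \<open>C\<close>, and openness onto the image yields
  \<open>D\<close>.\<close>

lemma strict_inclusion_norms_equivalent:
  assumes S: "unital_Banach_algebra smul S \<nu>" and R: "unital_Banach_algebra smul R \<mu>"
    and sub: "S \<subseteq> R"
    and emb: "embedding_map (norm_topology S \<nu>) (norm_topology R \<mu>) (\<lambda>x. x)"
  obtains C D where "C > 0" "D > 0" "\<And>x. x \<in> S \<Longrightarrow> \<mu> x \<le> C * \<nu> x" "\<And>x. x \<in> S \<Longrightarrow> \<nu> x \<le> D * \<mu> x"
proof -
  interpret S: unital_Banach_algebra smul S \<nu> by (rule S)
  interpret R: unital_Banach_algebra smul R \<mu> by (rule R)
  have hom: "homeomorphic_map (norm_topology S \<nu>) (subtopology (norm_topology R \<mu>) S) (\<lambda>x. x)"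
    using emb by (simp add: embedding_map_def S.topspace_norm_topology)
  have open_iff: "openin (subtopology (norm_topology R \<mu>) S) U \<longleftrightarrow> openin (norm_topology S \<nu>) U"
    if "U \<subseteq> S" for U
    using homeomorphic_map_openness [OF hom, of U] that by (simp add: S.topspace_norm_topology)
  have "openin (subtopology (norm_topology R \<mu>) S) ({x \<in> R. \<mu> x < 1} \<inter> S)"
    using R.openin_norm_ball openin_subtopology by blast
  then have "openin (norm_topology S \<nu>) ({x \<in> R. \<mu> x < 1} \<inter> S)"
    using open_iff by blast
  moreover have "0 \<in> {x \<in> R. \<mu> x < 1} \<inter> S" using S.zero_mem R.zero_mem R.norm_zero by simp
  ultimately have "\<exists>r>0. \<forall>x\<in>S. \<nu> (x - 0) < r \<longrightarrow> x \<in> {x \<in> R. \<mu> x < 1} \<inter> S"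
    unfolding S.openin_norm_topology by blast
  then obtain r where r: "r > 0" "\<And>x. x \<in> S \<Longrightarrow> \<nu> x < r \<Longrightarrow> \<mu> x < 1" by auto
  have "openin (subtopology (norm_topology R \<mu>) S) {x \<in> S. \<nu> x < 1}"
    by (subst open_iff) (auto intro: S.openin_norm_ball)
  then obtain V where V: "openin (norm_topology R \<mu>) V" "{x \<in> S. \<nu> x < 1} = V \<inter> S"
    unfolding openin_subtopology by blast
  have "0 \<in> V \<inter> S" unfolding V(2) [symmetric] using S.zero_mem S.norm_zero by simp
  then have "\<exists>s>0. \<forall>x\<in>R. \<mu> (x - 0) < s \<longrightarrow> x \<in> V"
    using V(1) unfolding R.openin_norm_topology by blast
  then obtain s where s: "s > 0" and V_ball: "\<And>x. x \<in> R \<Longrightarrow> \<mu> x < s \<Longrightarrow> x \<in> V" by auto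
  have s_ball: "\<nu> x < 1" if "x \<in> S" "\<mu> x < s" for x
  proof -
    have "x \<in> V \<inter> S" using V_ball that sub by blast
    then show ?thesis unfolding V(2) [symmetric] by simp
  qed
  show thesis
  proof
    show "2 / r > 0" "2 / s > 0" using r s by auto
    have zero: "\<nu> x = 0 \<longleftrightarrow> \<mu> x = 0" if "x \<in> S" for x
      using that sub S.norm_eq_zero R.norm_eq_zero by blast
    show "\<mu> x \<le> 2 / r * \<nu> x" if "x \<in> S" for x
      by (rule norm_le_if_bounded_on_ball [where smul = smul and S = S, OF r S.scale_mem])
        (use that sub zero S.norm_nonneg S.norm_scale R.norm_scale in auto)
    show "\<nu> x \<le> 2 / s * \<mu> x" if "x \<in> S" for x
      by (rule norm_le_if_bounded_on_ball [where smul = smul and S = S, OF s s_ball S.scale_mem])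
        (use that sub zero R.norm_nonneg S.norm_scale R.norm_scale in auto)
  qed
qed

theorem mainTheorem7:
  fixes smul :: "'k::real_normed_field \<Rightarrow> 'a::{ring, monoid_mult} \<Rightarrow> 'a"
    and A :: "nat \<Rightarrow> 'a set"
    and \<nu> :: "nat \<Rightarrow> 'a \<Rightarrow> real"
    and T :: "'a topology"
  assumes Banach: "\<And>n. unital_Banach_algebra smul (A n) (\<nu> n)"
    and ascending: "\<And>n. A n \<subseteq> A (Suc n)"
    and continuous: "\<And>n. continuous_map (norm_topology (A n) (\<nu> n))
                           (norm_topology (A (Suc n)) (\<nu> (Suc n))) (\<lambda>x. x)"
    and union: "(\<Union>n. A n) = UNIV"
    and limit: "lc_direct_limit_topology smul (\<lambda>n. norm_topology (A n) (\<nu> n)) T"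
    and strict: "\<And>n. embedding_map (norm_topology (A n) (\<nu> n))
                       (norm_topology (A (Suc n)) (\<nu> (Suc n))) (\<lambda>x. x)"
  shows "complete_topological_group TYPE('i) (unit_group :: 'a monoid)
           (subtopology T (carrier unit_group))"
proof -
  have succ: "\<exists>C D. 0 < C \<and> 0 < D \<and> (\<forall>x\<in>A n. \<nu> (Suc n) x \<le> C * \<nu> n x \<and> \<nu> n x \<le> D * \<nu> (Suc n) x)" for n
    using strict_inclusion_norms_equivalent [OF Banach Banach ascending strict, of n] by metis
  have mono: "A i \<subseteq> A j" if "i \<le> j" for i j using lift_Suc_mono_le [of A, OF ascending that] .
  have equiv: "\<exists>C D. 0 < C \<and> 0 < D \<and> (\<forall>x\<in>A i. \<nu> j x \<le> C * \<nu> i x \<and> \<nu> i x \<le> D * \<nu> j x)"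
    if "i \<le> j" for i j
    using that
  proof (induction j rule: dec_induct)
    case base
    show ?case by (intro exI [of _ 1]) simp
  next
    case (step m)
    obtain C D where CD: "0 < C" "0 < D" "\<And>x. x \<in> A i \<Longrightarrow> \<nu> m x \<le> C * \<nu> i x"
      "\<And>x. x \<in> A i \<Longrightarrow> \<nu> i x \<le> D * \<nu> m x"
      using step.IH by blast
    obtain C' D' where CD': "0 < C'" "0 < D'" "\<And>x. x \<in> A m \<Longrightarrow> \<nu> (Suc m) x \<le> C' * \<nu> m x"
      "\<And>x. x \<in> A m \<Longrightarrow> \<nu> m x \<le> D' * \<nu> (Suc m) x"
      using succ [of m] by blast
    have "\<nu> (Suc m) x \<le> C' * C * \<nu> i x \<and> \<nu> i x \<le> D * D' * \<nu> (Suc m) x" if "x \<in> A i" for x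
    proof -
      have m: "x \<in> A m" using that mono [OF step.hyps(1)] by blast
      have "C' * \<nu> m x \<le> C' * (C * \<nu> i x)" "D * \<nu> m x \<le> D * (D' * \<nu> (Suc m) x)"
        using CD(1,2) CD'(1,2) CD(3) [OF that] CD'(4) [OF m] by (simp_all add: mult_left_mono)
      then show ?thesis using CD(4) [OF that] CD'(3) [OF m] by simp
    qed
    then show ?case using CD(1,2) CD'(1,2) mult_pos_pos by meson
  qed
  \<comment> \<open>For \<open>i > j\<close>, membership in both steps amounts to membership in
    \<open>A j\<close>, and the constant is the \<open>D\<close> supplied by strictness.\<close>
  have "\<exists>C>0. \<forall>x. x \<in> A i \<longrightarrow> x \<in> A j \<longrightarrow> \<nu> j x \<le> C * \<nu> i x" for i j
  proof (cases "i \<le> j")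
    case True
    then show ?thesis using equiv by blast
  next
    case False
    then show ?thesis using equiv [of j i] by (meson nat_le_linear)
  qed
  then obtain K where K: "\<And>i j. 0 < K i j" "\<And>i j x. x \<in> A i \<Longrightarrow> x \<in> A j \<Longrightarrow> \<nu> j x \<le> K i j * \<nu> i x"
    by metis
  interpret strict_Banach_algebra_sequence smul A \<nu> K
    by (rule strict_Banach_algebra_sequence.intro) (use Banach ascending union K in auto)
  have "T = limit_topology"
    using lc_direct_limit_topology_unique [OF limit lc_direct_limit_topology_limit_topology] .
  then show ?thesis using complete_topological_group_units by simp
qed

end
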